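(* There is an algorithm that, given a cognitive radio network whose potential graph is a tree, decides whether it is connectable in time $2^{O(t)}(kn)^{O(1)}$, where $n$ is the number of SUs, $k$ the number of channels, and $t=\max_{u\in U}|\textsc{SpecMap}(u)|$. In particular the running time is at most $2^{O(k)}n^{O(1)}$.
   Context: A cognitive radio network consists of: a finite set $U$ of secondary users (SUs), $n=|U|$; a finite set $C$ of channels, $k=|C|$; for each $u\in U$ a spectrum map $\textsc{SpecMap}(u)\subseteq C$; a simple undirected graph $\mathcal{PG}=(U,E)$ called the potential graph; and for each $u\in U$ a positive integer antenna budget $\beta(u)$. A spectrum assignment is a function $\mathcal{SA}:U\to 2^C$ with $\mathcal{SA}(u)\subseteq \textsc{SpecMap}(u)$ and $|\mathcal{SA}(u)|\le\beta(u)$ for all $u$. A potential edge $\{u,v\}\in E$ is realized under $\mathcal{SA}$ if $\mathcal{SA}(u)\cap\mathcal{SA}(v)\neq\emptyset$; the realization graph is $(U,E')$ where $E'$ is the set of realized edges. The network is connectable if some spectrum assignment makes the realization graph connected. *)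

theory Defs
  imports Main
begin

section \<open>Simple undirected graphs\<close>

text \<open>An edge is a two-element set of vertices.\<close>

definition simple_graph :: "'a set \<Rightarrow> 'a set set \<Rightarrow> bool" where
  "simple_graph V E \<longleftrightarrow> (\<forall>e\<in>E. e \<subseteq> V \<and> card e = 2)"

definition connected_graph :: "'a set \<Rightarrow> 'a set set \<Rightarrow> bool" where
  "connected_graph V E \<longleftrightarrow>
     V \<noteq> {} \<and> (\<forall>u\<in>V. \<forall>v\<in>V. (u, v) \<in> {(x, y). {x, y} \<in> E}\<^sup>*)"

definition graph_cycle :: "'a set set \<Rightarrow> 'a list \<Rightarrow> bool" where
  "graph_cycle E vs \<longleftrightarrow>
     length vs \<ge> 3 \<and> distinct vs \<and>
     (\<forall>i. Suc i < length vs \<longrightarrow> {vs ! i, vs ! Suc i} \<in> E) \<and> {last vs, hd vs} \<in> E"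

definition tree_graph :: "'a set \<Rightarrow> 'a set set \<Rightarrow> bool" where
  "tree_graph V E \<longleftrightarrow>
     simple_graph V E \<and> connected_graph V E \<and> (\<nexists>vs. graph_cycle E vs)"


section \<open>Cognitive radio networks\<close>

record ('u, 'c) network =
  users :: "'u set"
  channels :: "'c set"
  spec_map :: "'u \<Rightarrow> 'c set"
  potential_edges :: "'u set set"
  budget :: "'u \<Rightarrow> nat"

definition cognitive_radio_network :: "('u, 'c) network \<Rightarrow> bool" where
  "cognitive_radio_network N \<longleftrightarrow>
     finite (users N) \<and> finite (channels N) \<and>
     (\<forall>u\<in>users N. spec_map N u \<subseteq> channels N) \<and>
     simple_graph (users N) (potential_edges N) \<and>
     (\<forall>u\<in>users N. budget N u > 0)"

definition spectrum_assignment :: "('u, 'c) network \<Rightarrow> ('u \<Rightarrow> 'c set) \<Rightarrow> bool" where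
  "spectrum_assignment N SA \<longleftrightarrow>
     (\<forall>u\<in>users N. SA u \<subseteq> spec_map N u \<and> card (SA u) \<le> budget N u)"

definition realized_edges :: "('u, 'c) network \<Rightarrow> ('u \<Rightarrow> 'c set) \<Rightarrow> 'u set set" where
  "realized_edges N SA =
     {e. \<exists>u v. e = {u, v} \<and> {u, v} \<in> potential_edges N \<and> SA u \<inter> SA v \<noteq> {}}"

definition connectable :: "('u, 'c) network \<Rightarrow> bool" where
  "connectable N \<longleftrightarrow>
     (\<exists>SA. spectrum_assignment N SA \<and> connected_graph (users N) (realized_edges N SA))"

definition max_spec :: "('u, 'c) network \<Rightarrow> nat" where
  "max_spec N = Max ((\<lambda>u. card (spec_map N u)) ` users N)"


section \<open>Random access machine programs\<close>

text \<open>
  A structured presentation of the unit-cost random access machine whose arithmetic consists of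
  addition and (truncated) subtraction. Memory is organised as named arrays of natural numbers; a
  program mentions finitely many names, so the arrays could be interleaved in a single memory.
  There is deliberately no unit-cost multiplication, with which the unit-cost measure would no
  longer be polynomially related to Turing machine time.
\<close>

type_synonym store = "string \<Rightarrow> nat \<Rightarrow> nat"

datatype aexp =
    Const nat
  | Get string aexp
  | Add aexp aexp
  | Sub aexp aexp

datatype bexp =
    Less aexp aexp
  | Not bexp
  | And bexp bexp

datatype com =
    Skip
  | Put string aexp aexp
  | Seq com com
  | If bexp com com
  | While bexp com

primrec aval :: "aexp \<Rightarrow> store \<Rightarrow> nat" where
  "aval (Const n) s = n"
| "aval (Get x a) s = s x (aval a s)"
| "aval (Add a b) s = aval a s + aval b s"
| "aval (Sub a b) s = aval a s - aval b s"

primrec bval :: "bexp \<Rightarrow> store \<Rightarrow> bool" where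
  "bval (Less a b) s \<longleftrightarrow> aval a s < aval b s"
| "bval (Not b) s \<longleftrightarrow> \<not> bval b s"
| "bval (And b c) s \<longleftrightarrow> bval b s \<and> bval c s"

text \<open>Evaluation costs one step per syntax node; conjunctions are evaluated in full.\<close>

primrec acost :: "aexp \<Rightarrow> nat" where
  "acost (Const n) = 1"
| "acost (Get x a) = 1 + acost a"
| "acost (Add a b) = 1 + acost a + acost b"
| "acost (Sub a b) = 1 + acost a + acost b"

primrec bcost :: "bexp \<Rightarrow> nat" where
  "bcost (Less a b) = 1 + acost a + acost b"
| "bcost (Not b) = 1 + bcost b"
| "bcost (And b c) = 1 + bcost b + bcost c"

text \<open>\<open>exec c s T s'\<close>: started in store \<open>s\<close>, the program \<open>c\<close> halts in store \<open>s'\<close> after \<open>T\<close> steps.\<close>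

inductive exec :: "com \<Rightarrow> store \<Rightarrow> nat \<Rightarrow> store \<Rightarrow> bool" where
  Skip: "exec Skip s 1 s"
| Put: "exec (Put x a b) s (1 + acost a + acost b) (s(x := (s x)(aval a s := aval b s)))"
| Seq: "exec c s T s' \<Longrightarrow> exec d s' T' s'' \<Longrightarrow> exec (Seq c d) s (T + T') s''"
| IfTrue: "bval b s \<Longrightarrow> exec c s T s' \<Longrightarrow> exec (If b c d) s (1 + bcost b + T) s'"
| IfFalse: "\<not> bval b s \<Longrightarrow> exec d s T s' \<Longrightarrow> exec (If b c d) s (1 + bcost b + T) s'"
| WhileFalse: "\<not> bval b s \<Longrightarrow> exec (While b c) s (1 + bcost b) s"
| WhileTrue: "bval b s \<Longrightarrow> exec c s T s' \<Longrightarrow> exec (While b c) s' T' s'' \<Longrightarrow>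
    exec (While b c) s (1 + bcost b + T + T') s''"

text \<open>Executions are deterministic, so \<open>\<exists>T s'. exec c s T s' \<and> \<dots>\<close> expresses total correctness.\<close>

lemma exec_deterministic:
  "exec c s T s' \<Longrightarrow> exec c s T' s'' \<Longrightarrow> T = T' \<and> s' = s''"
proof (induction arbitrary: T' s'' rule: exec.induct)
  case (Skip s)
  then show ?case by (auto elim: exec.cases)
next
  case (Put x a b s)
  then show ?case by (auto elim: exec.cases)
next
  case (Seq c s T s1 d T1 s2)
  from Seq.prems show ?case by cases (use Seq.IH in blast)
next
  case (IfTrue b s c T s1 d)
  from IfTrue.prems show ?case by cases (use IfTrue in blast)+
next
  case (IfFalse b s d T s1 c)
  from IfFalse.prems show ?case by cases (use IfFalse in blast)+
next
  case (WhileFalse b s c)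
  from WhileFalse.prems show ?case by cases (use WhileFalse in blast)+
next
  case (WhileTrue b s c T s1 T1 s2)
  from WhileTrue.prems show ?case by cases (use WhileTrue in blast)+
qed


section \<open>Input encoding\<close>

definition array :: "nat list \<Rightarrow> nat \<Rightarrow> nat" where
  "array xs i = (if i < length xs then xs ! i else 0)"

text \<open>
  Users and channels are referred to by their positions in the enumerations \<open>us\<close> and \<open>cs\<close>.
  The spectrum map is a row-major \<open>n \<times> k\<close> and the potential graph a row-major \<open>n \<times> n\<close> zero-one
  matrix; each antenna budget occupies one cell. All other memory is initially zero.
\<close>

definition input_store :: "('u, 'c) network \<Rightarrow> 'u list \<Rightarrow> 'c list \<Rightarrow> store" where
  "input_store N us cs = (\<lambda>_ _. 0)
     (''n'' := array [length us],
      ''k'' := array [length cs],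
      ''budget'' := array (map (budget N) us),
      ''spec'' := array (concat (map (\<lambda>u. map (\<lambda>c. of_bool (c \<in> spec_map N u)) cs) us)),
      ''adj'' := array (concat (map (\<lambda>u. map (\<lambda>v. of_bool ({u, v} \<in> potential_edges N)) us) us)))"

definition enumerates :: "'a list \<Rightarrow> 'a set \<Rightarrow> bool" where
  "enumerates xs A \<longleftrightarrow> distinct xs \<and> set xs = A"

end

theory Submission
  imports Defs
begin

text \<open>
  On a tree the realization graph is connected iff every potential edge is realized, so
  connectability is a binary constraint satisfaction problem on a tree whose variables are the users
  and whose values are the at most \<open>2\<^sup>t\<close> admissible channel sets of a user. On a tree, arc
  consistent domains always extend to a solution: starting from any value at a root, each new vertex
  is attached to the part already assigned by a single edge. The program therefore lists all pairs of
  a user and an admissible set, at most \<open>n 2\<^sup>t\<close> many, and repeatedly deletes those that meet no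
  remaining set of some neighbour. A round without a deletion leaves the greatest arc consistent
  subset, so as many rounds as there are pairs suffice, and no rooting of the tree is needed.
  For \<open>k = 0\<close> the first bound allows constant time only, and the program answers without
  looking at the graph.
\<close>

section \<open>Running time of programs with bounded loops\<close>

text \<open>A bound on the running time when no loop makes more than \<open>W\<close> iterations each time it is
  entered; both branches of a conditional are charged, to avoid a maximum.\<close>

primrec tcost :: "nat \<Rightarrow> com \<Rightarrow> nat" where
  "tcost W Skip = 1"
| "tcost W (Put x a b) = 1 + acost a + acost b"
| "tcost W (Seq c d) = tcost W c + tcost W d"
| "tcost W (If b c d) = 1 + bcost b + tcost W c + tcost W d"
| "tcost W (While b c) = W * (1 + bcost b + tcost W c) + (1 + bcost b)"

lemma le_mult_power_mono:
  fixes W :: nat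
  assumes "T \<le> C * W ^ d" "0 < W" "d \<le> d'"
  shows "T \<le> C * W ^ d'"
proof -
  have "W ^ d \<le> W ^ d'" using assms by (simp add: power_increasing)
  with assms(1) show ?thesis by (meson le_trans mult_le_mono2)
qed

text \<open>The program is fixed while \<open>W\<close> varies, so expression costs are constants
  and only loops raise the degree. Exponents of composed programs are added merely to dominate both;
  \<open>W > 0\<close> makes larger powers weaker bounds.\<close>

lemma tcost_polynomial: "\<exists>C d. \<forall>W>0. tcost W c \<le> C * W ^ d"
proof (induction c)
  case Skip
  have "\<forall>W>0. tcost W Skip \<le> 1 * W ^ 0" by simp
  then show ?case by blast
next
  case (Put x a b)
  have "\<forall>W>0. tcost W (Put x a b) \<le> (1 + acost a + acost b) * W ^ 0" by simp
  then show ?case by blast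
next
  case (Seq c1 c2)
  then obtain C1 d1 C2 d2 where *: "\<forall>W>0. tcost W c1 \<le> C1 * W ^ d1" "\<forall>W>0. tcost W c2 \<le> C2 * W ^ d2"
    by blast
  have "\<forall>W>0. tcost W (Seq c1 c2) \<le> (C1 + C2) * W ^ (d1 + d2)"
  proof (intro allI impI)
    fix W :: nat assume "0 < W"
    have "tcost W c1 \<le> C1 * W ^ (d1 + d2)" "tcost W c2 \<le> C2 * W ^ (d1 + d2)"
      using * \<open>0 < W\<close> by (auto intro: le_mult_power_mono[of _ C1 _ d1] le_mult_power_mono[of _ C2 _ d2])
    then show "tcost W (Seq c1 c2) \<le> (C1 + C2) * W ^ (d1 + d2)" by (simp add: add_mult_distrib)
  qed
  then show ?case by blast
next
  case (If b c1 c2)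
  then obtain C1 d1 C2 d2 where *: "\<forall>W>0. tcost W c1 \<le> C1 * W ^ d1" "\<forall>W>0. tcost W c2 \<le> C2 * W ^ d2"
    by blast
  have "\<forall>W>0. tcost W (If b c1 c2) \<le> (1 + bcost b + C1 + C2) * W ^ (d1 + d2)"
  proof (intro allI impI)
    fix W :: nat assume "0 < W"
    have "tcost W c1 \<le> C1 * W ^ (d1 + d2)" "tcost W c2 \<le> C2 * W ^ (d1 + d2)"
      using * \<open>0 < W\<close> by (auto intro: le_mult_power_mono[of _ C1 _ d1] le_mult_power_mono[of _ C2 _ d2])
    moreover have "1 + bcost b \<le> (1 + bcost b) * W ^ (d1 + d2)"
      by (rule le_mult_power_mono[of _ _ _ 0, OF _ \<open>0 < W\<close>]) auto
    ultimately show "tcost W (If b c1 c2) \<le> (1 + bcost b + C1 + C2) * W ^ (d1 + d2)"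
      by (simp only: tcost.simps add_mult_distrib)
  qed
  then show ?case by blast
next
  case (While b c)
  then obtain C d where *: "\<forall>W>0. tcost W c \<le> C * W ^ d" by blast
  have "\<forall>W>0. tcost W (While b c) \<le> (2 * (1 + bcost b) + C) * W ^ Suc d"
  proof (intro allI impI)
    fix W :: nat assume "0 < W"
    have "W * tcost W c \<le> C * W ^ Suc d" using * \<open>0 < W\<close> by (simp add: ac_simps)
    moreover have "W * (1 + bcost b) \<le> (1 + bcost b) * W ^ Suc d"
      by (rule le_mult_power_mono[of _ _ _ 1, OF _ \<open>0 < W\<close>]) auto
    moreover have "1 + bcost b \<le> (1 + bcost b) * W ^ Suc d"
      by (rule le_mult_power_mono[of _ _ _ 0, OF _ \<open>0 < W\<close>]) auto
    moreover have "tcost W (While b c) = W * (1 + bcost b) + W * tcost W c + (1 + bcost b)"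
      by (simp add: algebra_simps)
    ultimately show "tcost W (While b c) \<le> (2 * (1 + bcost b) + C) * W ^ Suc d"
      unfolding add_mult_distrib mult_2 by linarith
  qed
  then show ?case by blast
qed

text \<open>Total correctness in the style of weakest preconditions: a postcondition may again be a
  \<open>runs\<close> assertion, so sequences are handled by nesting. The time limit depends on
  syntax and \<open>W\<close> only, so correctness proofs mention time solely through bounds on loop
  limits.\<close>

definition runs :: "nat \<Rightarrow> com \<Rightarrow> store \<Rightarrow> (store \<Rightarrow> bool) \<Rightarrow> bool" where
  "runs W c s Q \<longleftrightarrow> (\<exists>T s'. exec c s T s' \<and> T \<le> tcost W c \<and> Q s')"

lemma runs_mono: "runs W c s Q \<Longrightarrow> (\<And>s'. Q s' \<Longrightarrow> Q' s') \<Longrightarrow> runs W c s Q'"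
  unfolding runs_def by blast

lemma runs_Skip: "Q s \<Longrightarrow> runs W Skip s Q"
  unfolding runs_def using exec.Skip by fastforce

lemma runs_Put: "Q (s(x := (s x)(aval a s := aval b s))) \<Longrightarrow> runs W (Put x a b) s Q"
  unfolding runs_def using exec.Put by fastforce

lemma runs_Seq: "runs W c s (\<lambda>s'. runs W d s' Q) \<Longrightarrow> runs W (Seq c d) s Q"
  unfolding runs_def tcost.simps by (meson exec.Seq add_mono)

lemma runs_If:
  assumes "bval b s \<Longrightarrow> runs W c s Q" "\<not> bval b s \<Longrightarrow> runs W d s Q"
  shows "runs W (If b c d) s Q"
proof (cases "bval b s")
  case True
  with assms(1) obtain T s' where "exec c s T s'" "T \<le> tcost W c" "Q s'" unfolding runs_def by blast
  then show ?thesis unfolding runs_def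
    by (intro exI[of _ "1 + bcost b + T"] exI[of _ s']) (simp add: exec.IfTrue[OF True, simplified])
next
  case False
  with assms(2) obtain T s' where "exec d s T s'" "T \<le> tcost W d" "Q s'" unfolding runs_def by blast
  then show ?thesis unfolding runs_def
    by (intro exI[of _ "1 + bcost b + T"] exI[of _ s']) (simp add: exec.IfFalse[OF False, simplified])
qed

abbreviation var :: "string \<Rightarrow> aexp" where
  "var x \<equiv> Get x (Const 0)"

abbreviation assign :: "string \<Rightarrow> aexp \<Rightarrow> com" where
  "assign x a \<equiv> Put x (Const 0) a"

abbreviation eq :: "aexp \<Rightarrow> aexp \<Rightarrow> bexp" where
  "eq a b \<equiv> And (Not (Less a b)) (Not (Less b a))"

definition For :: "string \<Rightarrow> string \<Rightarrow> com \<Rightarrow> com" where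
  "For x y c = Seq (assign x (Const 0))
     (While (Less (var x) (var y)) (Seq c (assign x (Add (var x) (Const 1)))))"

text \<open>The invariant ignores the whole array \<open>x\<close>, so it survives the reset and the
  increments of the counter. The limit is read again before each iteration, hence the invariant must
  pin \<open>y\<close> to \<open>N\<close>; for the time, \<open>N <= W\<close> is enough.\<close>

lemma runs_For:
  assumes "N \<le> W" and init: "I 0 s"
    and indep: "\<And>i s v. I i s \<Longrightarrow> I i (s(x := v))"
    and bound: "\<And>i s. I i s \<Longrightarrow> s y 0 = N"
    and step: "\<And>i s. i < N \<Longrightarrow> I i s \<Longrightarrow> s x 0 = i \<Longrightarrow> runs W c s (\<lambda>s'. s' x 0 = i \<and> I (Suc i) s')"
    and post: "\<And>s. I N s \<Longrightarrow> Q s"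
  shows "runs W (For x y c) s Q"
proof -
  define b where "b = Less (var x) (var y)"
  define d where "d = Seq c (assign x (Add (var x) (Const 1)))"
  \<comment> \<open>Induction on the number of remaining iterations, with the exact factor
    \<open>N - i\<close> in place of \<open>W\<close>.\<close>
  have while: "\<exists>T s'. exec (While b d) s T s' \<and> T \<le> (N - i) * (1 + bcost b + tcost W d) + (1 + bcost b) \<and> I N s'"
    if "i \<le> N" "I i s" "s x 0 = i" for i s
    using that
  proof (induction "N - i" arbitrary: i s)
    case 0
    then have "\<not> bval b s" "i = N" using bound[of i s] by (auto simp: b_def)
    then have "exec (While b d) s (1 + bcost b) s" by (blast intro: exec.WhileFalse)
    with 0 \<open>i = N\<close> show ?case by fastforce
  next
    case (Suc l)
    then have *: "bval b s" "i < N" using bound[of i s] by (auto simp: b_def)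
    from step[OF *(2) Suc.prems(2,3)] have "runs W d s (\<lambda>s'. I (Suc i) s' \<and> s' x 0 = Suc i)"
      unfolding d_def by (intro runs_Seq, elim runs_mono) (intro runs_Put, auto intro: indep)
    then obtain T s' where d: "exec d s T s'" "T \<le> tcost W d" "I (Suc i) s'" "s' x 0 = Suc i"
      unfolding runs_def by blast
    have "l = N - Suc i" "Suc i \<le> N" using Suc.hyps(2) *(2) by auto
    from Suc.hyps(1)[OF this d(3,4)] obtain T' s'' where
      w: "exec (While b d) s' T' s''" "T' \<le> (N - Suc i) * (1 + bcost b + tcost W d) + (1 + bcost b)" "I N s''"
      by blast
    have "N - i = Suc (N - Suc i)" using *(2) by simp
    then have "1 + bcost b + T + T' \<le> (N - i) * (1 + bcost b + tcost W d) + (1 + bcost b)"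
      using w(2) d(2) by simp
    with exec.WhileTrue[OF *(1) d(1) w(1)] w(3) show ?case by blast
  qed
  let ?s = "s(x := (s x)(0 := 0))"
  \<comment> \<open>Replacing the factor \<open>N\<close> by \<open>W\<close> turns the exact count
    into the bound used by \<open>tcost\<close>.\<close>
  have "N * (1 + bcost b + tcost W d) \<le> W * (1 + bcost b + tcost W d)"
    using \<open>N \<le> W\<close> by (rule mult_le_mono1)
  then have "runs W (While b d) ?s Q"
    using while[of 0 ?s] indep[OF init] post unfolding runs_def by fastforce
  then show ?thesis
    unfolding For_def b_def[symmetric] d_def[symmetric] by (intro runs_Seq runs_Put) simp
qed


section \<open>The program\<close>

text \<open>
  Candidate \<open>i < m\<close> is the pair of the user \<open>owner[i]\<close> and the channel set whose characteristic
  vector is row \<open>i\<close> of the row-major matrix \<open>mem\<close>; \<open>size[i]\<close> is the cardinality of that set. The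
  machine cannot multiply, so \<open>mulk[i] = i * k\<close> and \<open>muln[u] = u * n\<close> are tabulated. Candidates are
  marked as deleted in \<open>dead\<close>, which makes the initial zero memory the right start.
\<close>

definition init_users :: com where
  "init_users = Seq (For ''u'' ''n'' (Seq (Put ''owner'' (var ''u'') (var ''u''))
     (Seq (Put ''mulk'' (Add (var ''u'') (Const 1)) (Add (Get ''mulk'' (var ''u'')) (var ''k'')))
          (Put ''muln'' (Add (var ''u'') (Const 1)) (Add (Get ''muln'' (var ''u'')) (var ''n''))))))
     (assign ''m'' (var ''n''))"

definition copy_row :: com where
  "copy_row = For ''d'' ''k'' (Put ''mem'' (Add (Get ''mulk'' (var ''m'')) (var ''d''))
     (Get ''mem'' (Add (Get ''mulk'' (var ''j'')) (var ''d''))))"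

definition add_candidate :: com where
  "add_candidate = Seq copy_row
    (Seq (Put ''mem'' (Add (Get ''mulk'' (var ''m'')) (var ''c'')) (Const 1))
    (Seq (Put ''owner'' (var ''m'') (Get ''owner'' (var ''j'')))
    (Seq (Put ''size'' (var ''m'') (Add (Get ''size'' (var ''j'')) (Const 1)))
    (Seq (Put ''mulk'' (Add (var ''m'') (Const 1)) (Add (Get ''mulk'' (var ''m'')) (var ''k'')))
         (assign ''m'' (Add (var ''m'') (Const 1)))))))"

definition extend_candidates :: com where
  "extend_candidates = For ''j'' ''e''
     (If (And (Less (Const 0) (Get ''spec'' (Add (Get ''mulk'' (Get ''owner'' (var ''j''))) (var ''c''))))
              (Less (Get ''size'' (var ''j'')) (Get ''budget'' (Get ''owner'' (var ''j'')))))
       add_candidate Skip)"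

definition generate :: com where
  "generate = Seq init_users (For ''c'' ''k'' (Seq (assign ''e'' (var ''m'')) extend_candidates))"

definition test_share :: com where
  "test_share = For ''c'' ''k''
     (If (And (Less (Const 0) (Get ''mem'' (Add (Get ''mulk'' (var ''i'')) (var ''c''))))
              (Less (Const 0) (Get ''mem'' (Add (Get ''mulk'' (var ''j'')) (var ''c'')))))
       (assign ''found'' (Const 1)) Skip)"

definition find_support :: com where
  "find_support = Seq (assign ''found'' (Const 0)) (For ''j'' ''m''
     (If (And (Less (Get ''dead'' (var ''j'')) (Const 1)) (eq (Get ''owner'' (var ''j'')) (var ''v'')))
       test_share Skip))"

definition filter_candidate :: com where
  "filter_candidate = For ''v'' ''n'' (Seq find_support
     (If (And (Less (Const 0) (Get ''adj'' (Add (Get ''muln'' (Get ''owner'' (var ''i''))) (var ''v''))))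
              (Less (var ''found'') (Const 1)))
       (Put ''dead'' (var ''i'') (Const 1)) Skip))"

definition filter_all :: com where
  "filter_all = For ''r'' ''m'' (For ''i'' ''m'' filter_candidate)"

definition read_result :: com where
  "read_result = For ''i'' ''m''
     (If (And (Less (Get ''owner'' (var ''i'')) (Const 1)) (Less (Get ''dead'' (var ''i'')) (Const 1)))
       (assign ''result'' (Const 1)) Skip)"

definition decide_connectable :: com where
  "decide_connectable = If (Less (Const 0) (var ''k''))
     (Seq generate (Seq filter_all read_result))
     (assign ''result'' (Sub (Const 2) (var ''n'')))"

section \<open>Correctness of the program\<close>

locale search_space =
  fixes n k W :: nat and spec adj :: "nat \<Rightarrow> nat \<Rightarrow> bool" and bud :: "nat \<Rightarrow> nat"
begin

section \<open>Candidates and their enumeration channel by channel\<close>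

definition cands :: "(nat \<times> nat set) set" where
  "cands = {(u, S). u < n \<and> S \<subseteq> {c. c < k \<and> spec u c} \<and> card S \<le> bud u}"

text \<open>Arc consistency of the sets in \<open>X\<close> as domains of the users.\<close>

definition consistent :: "(nat \<times> nat set) set \<Rightarrow> bool" where
  "consistent X \<longleftrightarrow> X \<subseteq> cands \<and>
     (\<forall>(u, S)\<in>X. \<forall>v<n. adj u v \<longrightarrow> (\<exists>S'. (v, S') \<in> X \<and> S \<inter> S' \<noteq> {}))"

text \<open>The contents of the table once the channels below \<open>b\<close> have been
  processed.\<close>

definition cands_upto :: "nat \<Rightarrow> (nat \<times> nat set) set" where
  "cands_upto b = {(u, S) \<in> cands. S \<subseteq> {..<b}}"

definition extend :: "nat \<Rightarrow> (nat \<times> nat set) set \<Rightarrow> (nat \<times> nat set) set" where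
  "extend b X = (\<lambda>(u, S). (u, insert b S)) ` {(u, S) \<in> X. spec u b \<and> card S < bud u}"

lemma finite_cands: "finite cands"
  by (rule finite_subset[of _ "{..<n} \<times> Pow {..<k}"]) (auto simp: cands_def)

lemma cands_upto_0: "cands_upto 0 = (\<lambda>u. (u, {})) ` {..<n}"
  by (auto simp: cands_upto_def cands_def)

lemma cands_upto_k: "cands_upto k = cands"
  by (auto simp: cands_upto_def cands_def)

lemma extend_insert:
  "extend b (insert (u, S) X) =
     (if spec u b \<and> card S < bud u then insert (u, insert b S) (extend b X) else extend b X)"
  by (auto simp: extend_def)

text \<open>Split on whether \<open>b\<close> lies in the set. If it does, the set arises from
  \<open>S - {b}\<close>, which is strictly smaller and therefore passes the strict budget test in
  \<open>extend\<close>.\<close>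

lemma cands_upto_Suc:
  assumes "b < k"
  shows "cands_upto (Suc b) = cands_upto b \<union> extend b (cands_upto b)"
proof (intro equalityI subrelI)
  fix u S assume *: "(u, S) \<in> cands_upto (Suc b)"
  then have fin: "finite S" by (auto simp: cands_upto_def intro: finite_subset)
  show "(u, S) \<in> cands_upto b \<union> extend b (cands_upto b)"
  proof (cases "b \<in> S")
    case True
    then have "card (S - {b}) < card S" by (rule card_Diff1_less[OF fin])
    with * True have "(u, S - {b}) \<in> cands_upto b" "spec u b" "card (S - {b}) < bud u"
      by (auto simp: cands_upto_def cands_def less_Suc_eq)
    moreover have "S = insert b (S - {b})" using True by blast
    ultimately show ?thesis unfolding extend_def by (auto intro!: image_eqI[of _ _ "(u, S - {b})"])
  next
    case False
    with * show ?thesis by (auto simp: cands_upto_def less_Suc_eq)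
  qed
next
  fix u S assume "(u, S) \<in> cands_upto b \<union> extend b (cands_upto b)"
  then consider "(u, S) \<in> cands_upto b"
    | S' where "S = insert b S'" "(u, S') \<in> cands_upto b" "spec u b" "card S' < bud u"
    by (auto simp: extend_def)
  then show "(u, S) \<in> cands_upto (Suc b)"
  proof cases
    case 1
    then show ?thesis by (auto simp: cands_upto_def)
  next
    case 2
    then have "finite S'" "b \<notin> S'" by (auto simp: cands_upto_def intro: finite_subset)
    then show ?thesis using 2 assms by (auto simp: cands_upto_def cands_def)
  qed
qed

text \<open>Sets below \<open>b\<close> do not contain \<open>b\<close>, so inserting
  \<open>b\<close> is injective on them and leads outside \<open>cands_upto b\<close>. Thus the
  table never holds duplicates, which is what bounds its length by
  \<open>card cands\<close>.\<close>

lemma extend_fresh: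
  assumes "X \<subseteq> cands_upto b" "(u, S) \<in> cands_upto b" "(u, S) \<notin> X"
  shows "(u, insert b S) \<notin> cands_upto b \<union> extend b X"
proof
  have notin: "b \<notin> S'" if "(u', S') \<in> cands_upto b" for u' S'
    using that by (auto simp: cands_upto_def)
  assume "(u, insert b S) \<in> cands_upto b \<union> extend b X"
  then obtain S' where "(u, S') \<in> X" "insert b S = insert b S'"
    using notin[of u "insert b S"] by (auto simp: extend_def)
  with notin assms have "S = S'" by (metis insert_ident subsetD)
  with \<open>(u, S') \<in> X\<close> assms(3) show False by simp
qed

section \<open>Representation of input and candidates in memory\<close>

definition inputs :: "store \<Rightarrow> bool" where
  "inputs s \<longleftrightarrow> s ''n'' 0 = n \<and> s ''k'' 0 = k \<and> (\<forall>u<n. s ''budget'' u = bud u) \<and>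
     (\<forall>u<n. \<forall>c<k. s ''spec'' (u * k + c) = of_bool (spec u c)) \<and>
     (\<forall>u<n. \<forall>v<n. s ''adj'' (u * n + v) = of_bool (adj u v))"

text \<open>\<open>mulk\<close> is filled up to \<open>m\<close> inclusive, because row
  \<open>m\<close> is the one written next. The condition \<open>n <= m\<close> lets the same
  tabulated multiples address the rows of \<open>spec\<close>, which are indexed by users.\<close>

definition table :: "(nat \<Rightarrow> nat \<times> nat set) \<Rightarrow> nat \<Rightarrow> store \<Rightarrow> bool" where
  "table f m s \<longleftrightarrow> n \<le> m \<and> s ''m'' 0 = m \<and>
     (\<forall>i\<le>m. s ''mulk'' i = i * k) \<and> (\<forall>u\<le>n. s ''muln'' u = u * n) \<and>
     (\<forall>i<m. s ''owner'' i = fst (f i) \<and> s ''size'' i = card (snd (f i))) \<and>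
     (\<forall>i<m. \<forall>c<k. s ''mem'' (i * k + c) = of_bool (c \<in> snd (f i)))"

definition all_alive :: "store \<Rightarrow> bool" where
  "all_alive s \<longleftrightarrow> s ''dead'' = (\<lambda>_. 0) \<and> s ''result'' 0 = 0"

lemma inputs_upd [simp]:
  "x \<notin> {''n'', ''k'', ''budget'', ''spec'', ''adj''} \<Longrightarrow> inputs (s(x := v)) = inputs s"
  unfolding inputs_def by (simp only: fun_upd_apply insert_iff empty_iff simp_thms de_Morgan_disj not_sym if_False)

lemma table_upd [simp]:
  "x \<notin> {''m'', ''mulk'', ''muln'', ''owner'', ''size'', ''mem''} \<Longrightarrow>
     table f m (s(x := v)) = table f m s"
  unfolding table_def by (simp only: fun_upd_apply insert_iff empty_iff simp_thms de_Morgan_disj not_sym if_False)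

lemma all_alive_upd [simp]:
  "x \<notin> {''dead'', ''result''} \<Longrightarrow> all_alive (s(x := v)) = all_alive s"
  unfolding all_alive_def by (simp only: fun_upd_apply insert_iff empty_iff simp_thms de_Morgan_disj not_sym if_False)

section \<open>Generation of the candidates\<close>

lemma init_users:
  assumes "n \<le> W" "inputs s" "all_alive s"
    "\<forall>x\<in>{''mulk'', ''muln'', ''owner'', ''size'', ''mem''}. s x = (\<lambda>_. 0)"
  shows "runs W init_users s (\<lambda>s. inputs s \<and> all_alive s \<and> table (\<lambda>u. (u, {})) n s)"
proof -
  \<comment> \<open>The zero memory already encodes empty sets of size 0, so only owners and
    multiples have to be written. The multiples run one entry ahead of the owners.\<close>
  define I where "I = (\<lambda>i s. inputs s \<and> all_alive s \<and> (\<forall>j\<le>i. s ''mulk'' j = j * k \<and> s ''muln'' j = j * n) \<and>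
    (\<forall>j<i. s ''owner'' j = j) \<and> s ''size'' = (\<lambda>_. 0) \<and> s ''mem'' = (\<lambda>_. 0))"
  have "I 0 s" using assms by (simp add: I_def)
  have k: "s ''k'' 0 = k" "s ''n'' 0 = n" if "I i s" for i s using that by (simp_all add: I_def inputs_def)
  show ?thesis unfolding init_users_def
    apply (intro runs_Seq)
    apply (rule runs_For[where I = I and N = n])
         apply (fact assms)
        apply (fact \<open>I 0 s\<close>)
       apply (simp add: I_def)
      apply (simp add: k)
     apply (intro runs_Seq runs_Put)
    subgoal for i s
      using k[of i s] by (auto simp: I_def le_Suc_eq less_Suc_eq)
    apply (intro runs_Put)
    apply (auto simp: I_def table_def inputs_def all_alive_def)
    done
qed

text \<open>Quotient and remainder modulo \<open>l\<close> are unique; hence writing one matrix cell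
  leaves every other cell alone.\<close>

lemma row_major_eq:
  fixes c d i j l :: nat
  assumes "c < l" "d < l"
  shows "i * l + c = j * l + d \<longleftrightarrow> i = j \<and> c = d"
proof
  have "(i * l + c) div l = i" "(j * l + d) div l = j" using assms by simp_all
  moreover assume "i * l + c = j * l + d"
  ultimately show "i = j \<and> c = d" by simp
qed simp

lemma copy_row:
  assumes "k \<le> W" "inputs s" "table f m s" "j < m" "s ''j'' 0 = j"
  shows "runs W copy_row s (\<lambda>s'. (\<forall>x. x \<noteq> ''d'' \<longrightarrow> x \<noteq> ''mem'' \<longrightarrow> s' x = s x) \<and>
    (\<forall>i\<le>m. \<forall>c<k. s' ''mem'' (i * k + c) = of_bool (c \<in> snd (f (if i = m then j else i)))))"
proof -
  define I where "I = (\<lambda>d s'. (\<forall>x. x \<noteq> ''d'' \<longrightarrow> x \<noteq> ''mem'' \<longrightarrow> s' x = s x) \<and>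
    (\<forall>i<m. \<forall>c<k. s' ''mem'' (i * k + c) = of_bool (c \<in> snd (f i))) \<and>
    (\<forall>c<d. s' ''mem'' (m * k + c) = of_bool (c \<in> snd (f j))))"
  have "I 0 s" using assms by (simp add: I_def table_def)
  have *: "s' ''k'' 0 = k" "s' ''mulk'' m = m * k" "s' ''mulk'' j = j * k" "s' ''m'' 0 = m" "s' ''j'' 0 = j"
    if "I i s'" for i s' using that assms by (simp_all add: I_def inputs_def table_def)
  show ?thesis unfolding copy_row_def
    apply (rule runs_For[where I = I and N = k])
         apply (fact assms)
        apply (fact \<open>I 0 s\<close>)
       apply (simp add: I_def)
      apply (simp add: *)
     apply (intro runs_Put)
    subgoal for i s'
      using *[of i s'] assms by (auto simp: I_def less_Suc_eq row_major_eq)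
    apply (auto simp: I_def)
    done
qed

text \<open>All table writes go to row \<open>m\<close> or, for \<open>mulk\<close>, to entry
  \<open>m + 1\<close>, and \<open>m\<close> is advanced last, so existing candidates are
  undisturbed. Since \<open>b\<close> is new to \<open>S\<close>, the stored size grows by exactly
  one.\<close>

lemma add_candidate:
  assumes "k \<le> W" "inputs s" "table f m s" "j < m" "s ''j'' 0 = j" "s ''c'' 0 = b" "b < k"
    "f j = (u, S)" "finite S" "b \<notin> S"
  shows "runs W add_candidate s (\<lambda>s'. inputs s' \<and> table (f(m := (u, insert b S))) (Suc m) s' \<and>
    (\<forall>x\<in>{''j'', ''c'', ''e'', ''dead'', ''result''}. s' x = s x))"
  unfolding add_candidate_def
  apply (rule runs_Seq, rule runs_mono[OF copy_row[OF assms(1-5)]])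
  apply (intro runs_Seq runs_Put)
  subgoal premises prems for s'
  proof -
    have *: "s' ''k'' 0 = k" "s' ''mulk'' m = m * k" "s' ''m'' 0 = m" "s' ''j'' 0 = j" "s' ''c'' 0 = b"
      "s' ''owner'' j = u" "s' ''size'' j = card S"
      using prems assms by (simp_all add: inputs_def table_def)
    have "inputs s'" using prems assms by (simp add: inputs_def)
    moreover have "n \<le> m" "\<forall>i\<le>m. s' ''mulk'' i = i * k" "\<forall>u\<le>n. s' ''muln'' u = u * n"
      "\<forall>i<m. s' ''owner'' i = fst (f i) \<and> s' ''size'' i = card (snd (f i))"
      using prems assms(3) by (simp_all add: table_def)
    moreover have "\<forall>i\<le>m. \<forall>c<k. s' ''mem'' (i * k + c) = of_bool (c \<in> snd (f (if i = m then j else i)))"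
      using prems by blast
    ultimately show ?thesis
      using * assms(7-) prems by (auto simp: table_def le_Suc_eq less_Suc_eq row_major_eq)
  qed
  done

text \<open>The limit \<open>e\<close> is a snapshot of \<open>m\<close>: the table grows during the
  loop, but only candidates present at its start are extended.\<close>

lemma extend_candidates:
  assumes "card cands \<le> W" "k \<le> W" "b < k" "inputs s" "all_alive s" "table f e s" "s ''e'' 0 = e" "s ''c'' 0 = b"
    "bij_betw f {..<e} (cands_upto b)"
  shows "runs W extend_candidates s (\<lambda>s'. s' ''c'' 0 = b \<and> inputs s' \<and> all_alive s' \<and>
    (\<exists>f m. table f m s' \<and> bij_betw f {..<m} (cands_upto (Suc b))))"
proof -
  \<comment> \<open>The grown enumeration \<open>g\<close> agrees with \<open>f\<close> below
    \<open>e\<close>, so the loop still reads the original candidates.\<close>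
  define I where "I = (\<lambda>j s. s ''c'' 0 = b \<and> s ''e'' 0 = e \<and> inputs s \<and> all_alive s \<and>
    (\<exists>g m. table g m s \<and> e \<le> m \<and> (\<forall>i<e. g i = f i) \<and>
       bij_betw g {..<m} (cands_upto b \<union> extend b (f ` {..<j}))))"
  have "I 0 s" using assms by (auto simp: I_def extend_def)
  \<comment> \<open>Freedom from duplicates enters the running time here: the snapshot is at most
    \<open>card cands\<close>.\<close>
  have "e = card (cands_upto b)" using bij_betw_same_card[OF assms(9)] by simp
  also have "\<dots> \<le> card cands" by (rule card_mono[OF finite_cands]) (auto simp: cands_upto_def)
  finally have "e \<le> W" using assms(1) by simp
  have step: "runs W (If (And (Less (Const 0) (Get ''spec'' (Add (Get ''mulk'' (Get ''owner'' (var ''j''))) (var ''c''))))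
              (Less (Get ''size'' (var ''j'')) (Get ''budget'' (Get ''owner'' (var ''j''))))) add_candidate Skip)
       s (\<lambda>s'. s' ''j'' 0 = j \<and> I (Suc j) s')" if "j < e" "I j s" and j: "s ''j'' 0 = j" for j s
  proof -
    from \<open>I j s\<close> obtain g m where
      s: "s ''c'' 0 = b" "s ''e'' 0 = e" "inputs s" "all_alive s" and
      g: "table g m s" "e \<le> m" "\<forall>i<e. g i = f i" "bij_betw g {..<m} (cands_upto b \<union> extend b (f ` {..<j}))"
      unfolding I_def by blast
    obtain u S where uS: "f j = (u, S)" by fastforce
    have in_upto: "f i \<in> cands_upto b" if "i < e" for i
      using assms(9) that by (auto simp: bij_betw_def)
    have cand: "(u, S) \<in> cands_upto b" using in_upto[OF \<open>j < e\<close>] uS by simp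
    then have "u < n" "S \<subseteq> {..<b}" by (auto simp: cands_upto_def cands_def)
    then have S: "finite S" "b \<notin> S" by (auto intro: finite_subset)
    have gj: "g j = (u, S)" using g(3) uS \<open>j < e\<close> by simp
    have "n \<le> m" "j < m" using g \<open>j < e\<close> by (auto simp: table_def)
    have cond: "s ''spec'' (s ''mulk'' (s ''owner'' j) + b) = of_bool (spec u b)"
      "s ''size'' j = card S" "s ''budget'' (s ''owner'' j) = bud u"
      using s(3) g(1) gj \<open>j < m\<close> \<open>u < n\<close> \<open>b < k\<close> \<open>n \<le> m\<close> by (auto simp: table_def inputs_def)
    have lessThan: "{..<Suc j} = insert j {..<j}" by (auto simp: lessThan_Suc)
    show ?thesis
    proof (rule runs_If)
      assume "bval (And (Less (Const 0) (Get ''spec'' (Add (Get ''mulk'' (Get ''owner'' (var ''j''))) (var ''c''))))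
              (Less (Get ''size'' (var ''j'')) (Get ''budget'' (Get ''owner'' (var ''j''))))) s"
      then have ext: "extend b (f ` {..<Suc j}) = insert (u, insert b S) (extend b (f ` {..<j}))"
        using cond s j by (auto simp: lessThan uS extend_insert)
      let ?g = "g(m := (u, insert b S))"
      have "(u, insert b S) \<notin> cands_upto b \<union> extend b (f ` {..<j})"
      proof (rule extend_fresh[OF _ cand])
        show "f ` {..<j} \<subseteq> cands_upto b" using in_upto \<open>j < e\<close> by auto
        show "(u, S) \<notin> f ` {..<j}"
          using inj_onD[OF bij_betw_imp_inj_on[OF assms(9)]] \<open>j < e\<close> uS by fastforce
      qed
      moreover have "bij_betw ?g {..<m} (cands_upto b \<union> extend b (f ` {..<j}))"
        using g(4) by (rule bij_betw_cong[THEN iffD2, rotated]) simp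
      ultimately have "bij_betw ?g (insert m {..<m}) (insert (u, insert b S) (cands_upto b \<union> extend b (f ` {..<j})))"
        using notIn_Un_bij_betw[of m "{..<m}" ?g "cands_upto b \<union> extend b (f ` {..<j})"] by simp
      then have bij: "bij_betw ?g {..<Suc m} (cands_upto b \<union> extend b (f ` {..<Suc j}))"
        by (simp add: ext lessThan_Suc[of m])
      show "runs W add_candidate s (\<lambda>s'. s' ''j'' 0 = j \<and> I (Suc j) s')"
        apply (rule runs_mono[OF add_candidate[OF assms(2) s(3) g(1) \<open>j < m\<close> j s(1) assms(3) gj S]])
        using bij s j g(2,3) unfolding I_def all_alive_def
        by (auto intro!: exI[of _ ?g] exI[of _ "Suc m"])
    next
      assume "\<not> bval (And (Less (Const 0) (Get ''spec'' (Add (Get ''mulk'' (Get ''owner'' (var ''j''))) (var ''c''))))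
              (Less (Get ''size'' (var ''j'')) (Get ''budget'' (Get ''owner'' (var ''j''))))) s"
      then have "extend b (f ` {..<Suc j}) = extend b (f ` {..<j})"
        using cond s j by (auto simp: lessThan uS extend_insert)
      then show "runs W Skip s (\<lambda>s'. s' ''j'' 0 = j \<and> I (Suc j) s')"
        using \<open>I j s\<close> j by (intro runs_Skip) (simp add: I_def)
    qed
  qed
  show ?thesis unfolding extend_candidates_def
    apply (rule runs_For[where I = I and N = e, OF \<open>e \<le> W\<close> \<open>I 0 s\<close> _ _ step])
    using cands_upto_Suc[OF assms(3)] bij_betw_imp_surj_on[OF assms(9)] by (auto simp: I_def)
qed

lemma generate:
  assumes "n \<le> W" "k \<le> W" "card cands \<le> W" "inputs s" "all_alive s"
    "\<forall>x\<in>{''mulk'', ''muln'', ''owner'', ''size'', ''mem''}. s x = (\<lambda>_. 0)"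
  shows "runs W generate s (\<lambda>s. inputs s \<and> all_alive s \<and> (\<exists>f m. table f m s \<and> bij_betw f {..<m} cands))"
proof -
  define I where "I = (\<lambda>b s. inputs s \<and> all_alive s \<and> (\<exists>f m. table f m s \<and> bij_betw f {..<m} (cands_upto b)))"
  have init: "runs W init_users s (I 0)"
    apply (rule runs_mono[OF init_users[OF assms(1,4,5,6)]])
    unfolding I_def cands_upto_0
    by (auto intro!: exI[of _ "\<lambda>u. (u, {})"] exI[of _ n] simp: bij_betw_def inj_on_def)
  have step: "runs W (Seq (assign ''e'' (var ''m'')) extend_candidates) s (\<lambda>s'. s' ''c'' 0 = b \<and> I (Suc b) s')"
    if "b < k" "I b s" and b: "s ''c'' 0 = b" for b s
  proof -
    from \<open>I b s\<close> obtain f m where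
      s: "inputs s" "all_alive s" and f: "table f m s" "bij_betw f {..<m} (cands_upto b)"
      unfolding I_def by blast
    show ?thesis
      apply (intro runs_Seq runs_Put)
      apply (rule runs_mono[OF extend_candidates[where f = f and e = m and b = b]])
      using that s f assms by (auto simp: I_def) (simp add: table_def)
  qed
  show ?thesis unfolding generate_def
    apply (rule runs_Seq, rule runs_mono[OF init])
    apply (erule runs_For[where I = I and N = k, OF assms(2) _ _ _ step])
    by (auto simp: I_def inputs_def cands_upto_k)
qed

section \<open>Filtering to arc consistency\<close>

definition supported :: "(nat \<Rightarrow> nat \<times> nat set) \<Rightarrow> nat set \<Rightarrow> nat \<Rightarrow> nat \<Rightarrow> bool" where
  "supported f A i v \<longleftrightarrow> (\<exists>j\<in>A. fst (f j) = v \<and> snd (f i) \<inter> snd (f j) \<noteq> {})"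

definition stable :: "(nat \<Rightarrow> nat \<times> nat set) \<Rightarrow> nat set \<Rightarrow> bool" where
  "stable f A \<longleftrightarrow> (\<forall>i\<in>A. \<forall>v<n. adj (fst (f i)) v \<longrightarrow> supported f A i v)"

definition covers :: "(nat \<Rightarrow> nat \<times> nat set) \<Rightarrow> nat set \<Rightarrow> bool" where
  "covers f A \<longleftrightarrow> (\<forall>X. consistent X \<longrightarrow> X \<subseteq> f ` A)"

definition filtering :: "(nat \<Rightarrow> nat \<times> nat set) \<Rightarrow> nat \<Rightarrow> nat set \<Rightarrow> store \<Rightarrow> bool" where
  "filtering f m A s \<longleftrightarrow> inputs s \<and> table f m s \<and> s ''result'' 0 = 0 \<and> bij_betw f {..<m} cands \<and>
     A \<subseteq> {..<m} \<and> covers f A \<and> (\<forall>j<m. s ''dead'' j = of_bool (j \<notin> A))"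

lemma filtering_upd [simp]:
  "x \<notin> {''n'', ''k'', ''budget'', ''spec'', ''adj'', ''m'', ''mulk'', ''muln'', ''owner'', ''size'', ''mem'',
     ''result'', ''dead''} \<Longrightarrow> filtering f m A (s(x := v)) = filtering f m A s"
  unfolding filtering_def inputs_def table_def
  by (simp only: fun_upd_apply insert_iff empty_iff simp_thms de_Morgan_disj not_sym if_False)

lemma filtering_cong:
  assumes "\<forall>x. x \<notin> {''c'', ''found'', ''j''} \<longrightarrow> s' x = s x"
  shows "filtering f m A s' = filtering f m A s"
  using assms unfolding filtering_def inputs_def table_def by simp

lemma covers_remove:
  assumes "covers f A" "v < n" "adj (fst (f i)) v" "\<not> supported f A i v"
  shows "covers f (A - {i})"
  unfolding covers_def
proof (intro allI impI)
  fix X assume X: "consistent X"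
  with assms(1) have sub: "X \<subseteq> f ` A" by (simp add: covers_def)
  have "f i \<notin> X"
  proof
    assume "f i \<in> X"
    then have "(fst (f i), snd (f i)) \<in> X" by simp
    then obtain S' where "(v, S') \<in> X" "snd (f i) \<inter> S' \<noteq> {}"
      using X assms(2,3) unfolding consistent_def by fastforce
    moreover from this sub obtain j where "j \<in> A" "f j = (v, S')" by (metis imageE subsetD)
    ultimately show False using assms(4) unfolding supported_def by fastforce
  qed
  with sub show "X \<subseteq> f ` (A - {i})" by blast
qed

lemma test_share:
  assumes "k \<le> W" "filtering f m A s" "i < m" "j < m" "s ''i'' 0 = i" "s ''j'' 0 = j"
  shows "runs W test_share s (\<lambda>s'. (\<forall>x. x \<noteq> ''c'' \<longrightarrow> x \<noteq> ''found'' \<longrightarrow> s' x = s x) \<and>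
    s' ''found'' 0 = (if snd (f i) \<inter> snd (f j) \<noteq> {} then 1 else s ''found'' 0))"
proof -
  define I where "I = (\<lambda>c s'. (\<forall>x. x \<noteq> ''c'' \<longrightarrow> x \<noteq> ''found'' \<longrightarrow> s' x = s x) \<and>
    s' ''found'' 0 = (if snd (f i) \<inter> snd (f j) \<inter> {..<c} \<noteq> {} then 1 else s ''found'' 0))"
  \<comment> \<open>The set of a candidate contains only indices below \<open>k\<close>, so scanning
    the channels up to \<open>k\<close> sees the whole intersection.\<close>
  have "f i \<in> cands" using assms(2,3) by (auto simp: filtering_def bij_betw_def)
  then have sub: "snd (f i) \<inter> snd (f j) \<inter> {..<k} = snd (f i) \<inter> snd (f j)"
    by (auto simp: cands_def)
  have "I 0 s" by (simp add: I_def)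
  have s: "s ''k'' 0 = k" "s ''mulk'' i = i * k" "s ''mulk'' j = j * k"
    "\<forall>c<k. s ''mem'' (i * k + c) = of_bool (c \<in> snd (f i))"
    "\<forall>c<k. s ''mem'' (j * k + c) = of_bool (c \<in> snd (f j))"
    using assms by (simp_all add: filtering_def inputs_def table_def)
  have lessThan: "B \<inter> {..<Suc c} = (if c \<in> B then insert c (B \<inter> {..<c}) else B \<inter> {..<c})" for B c
    by (auto simp: less_Suc_eq)
  show ?thesis unfolding test_share_def
    apply (rule runs_For[where I = I and N = k, OF assms(1) \<open>I 0 s\<close>])
       apply (simp add: I_def)
      apply (simp add: I_def s)
     apply (rule runs_If)
      apply (rule runs_Put)
    subgoal for c s' using s assms(5,6) by (simp add: I_def lessThan)
     apply (rule runs_Skip)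
    subgoal for c s' using s assms(5,6) by (auto simp: I_def lessThan)
    apply (simp add: I_def sub)
    done
qed

lemma find_support:
  assumes "k \<le> W" "card cands \<le> W" "filtering f m A s" "i < m" "s ''i'' 0 = i" "s ''v'' 0 = v"
  shows "runs W find_support s (\<lambda>s'. (\<forall>x. x \<notin> {''c'', ''found'', ''j''} \<longrightarrow> s' x = s x) \<and>
    s' ''found'' 0 = of_bool (supported f A i v))"
proof -
  define I where "I = (\<lambda>j s'. (\<forall>x. x \<notin> {''c'', ''found'', ''j''} \<longrightarrow> s' x = s x) \<and>
    s' ''found'' 0 = of_bool (supported f (A \<inter> {..<j}) i v))"
  have "m = card cands" using assms(3) bij_betw_same_card by (fastforce simp: filtering_def)
  with assms have "m \<le> W" by simp
  have "I 0 (s(''found'' := (s ''found'')(0 := 0)))" by (auto simp: I_def supported_def)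
  moreover have "s ''m'' 0 = m" using assms by (simp add: filtering_def table_def)
  moreover have step: "runs W (If (And (Less (Get ''dead'' (var ''j'')) (Const 1)) (eq (Get ''owner'' (var ''j'')) (var ''v'')))
       test_share Skip) s' (\<lambda>s'. s' ''j'' 0 = j \<and> I (Suc j) s')"
    if "j < m" "I j s'" and j: "s' ''j'' 0 = j" for j s'
  proof -
    have "filtering f m A s'"
      using filtering_cong[of s' s] assms(3) \<open>I j s'\<close> by (simp add: I_def)
    then have s': "s' ''owner'' j = fst (f j)" "s' ''dead'' j = of_bool (j \<notin> A)" "s' ''i'' 0 = i" "s' ''v'' 0 = v"
      using assms that by (simp_all add: filtering_def table_def I_def)
    have supp: "supported f (A \<inter> {..<Suc j}) i v \<longleftrightarrow>
        supported f (A \<inter> {..<j}) i v \<or> j \<in> A \<and> fst (f j) = v \<and> snd (f i) \<inter> snd (f j) \<noteq> {}"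
      by (auto simp: supported_def lessThan_Suc Int_insert_right)
    show ?thesis
    proof (rule runs_If)
      assume "bval (And (Less (Get ''dead'' (var ''j'')) (Const 1)) (eq (Get ''owner'' (var ''j'')) (var ''v''))) s'"
      then have "j \<in> A" "fst (f j) = v" using s' j by auto
      then show "runs W test_share s' (\<lambda>s'. s' ''j'' 0 = j \<and> I (Suc j) s')"
        using \<open>I j s'\<close> j
        by (intro runs_mono[OF test_share[OF assms(1) \<open>filtering f m A s'\<close> assms(4) \<open>j < m\<close> s'(3) j]])
           (simp add: I_def supp)
    next
      assume "\<not> bval (And (Less (Get ''dead'' (var ''j'')) (Const 1)) (eq (Get ''owner'' (var ''j'')) (var ''v''))) s'"
      then have "\<not> (j \<in> A \<and> fst (f j) = v)" using s' j by auto
      then show "runs W Skip s' (\<lambda>s'. s' ''j'' 0 = j \<and> I (Suc j) s')"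
        using \<open>I j s'\<close> j by (intro runs_Skip) (auto simp: I_def supp)
    qed
  qed
  moreover have "A \<inter> {..<m} = A" using assms(3) by (auto simp: filtering_def)
  ultimately show ?thesis unfolding find_support_def
    apply (intro runs_Seq runs_Put)
    apply (rule runs_For[where I = I and N = m, OF \<open>m \<le> W\<close> _ _ _ step])
        apply (simp_all add: I_def)
    done
qed

text \<open>Support is tested against the current set, which may shrink during the loop. The two
  implications suffice for termination: a stable set is left alone, and if nothing was deleted then
  \<open>i\<close> has passed all tests against the unchanged \<open>A\<close>.\<close>

lemma filter_candidate:
  assumes "n \<le> W" "k \<le> W" "card cands \<le> W" "filtering f m A s" "i < m" "s ''i'' 0 = i" "s ''r'' 0 = r"
  shows "runs W filter_candidate s (\<lambda>s'. s' ''i'' 0 = i \<and> s' ''r'' 0 = r \<and>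
    (\<exists>A'. filtering f m A' s' \<and> A' \<subseteq> A \<and> (stable f A \<longrightarrow> A' = A) \<and>
       (A' = A \<longrightarrow> i \<in> A \<longrightarrow> (\<forall>v<n. adj (fst (f i)) v \<longrightarrow> supported f A i v))))"
proof -
  define I where "I = (\<lambda>w s'. s' ''i'' 0 = i \<and> s' ''r'' 0 = r \<and>
    (\<exists>A'. filtering f m A' s' \<and> A' \<subseteq> A \<and> (stable f A \<longrightarrow> A' = A) \<and>
       (A' = A \<longrightarrow> i \<in> A \<longrightarrow> (\<forall>v<w. adj (fst (f i)) v \<longrightarrow> supported f A i v))))"
  have "I 0 s" using assms by (auto simp: I_def)
  have step: "runs W (Seq find_support
     (If (And (Less (Const 0) (Get ''adj'' (Add (Get ''muln'' (Get ''owner'' (var ''i''))) (var ''v''))))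
              (Less (var ''found'') (Const 1)))
       (Put ''dead'' (var ''i'') (Const 1)) Skip)) s (\<lambda>s'. s' ''v'' 0 = v \<and> I (Suc v) s')"
    if "v < n" "I v s" and v: "s ''v'' 0 = v" for v s
  proof -
    from \<open>I v s\<close> obtain A' where s: "s ''i'' 0 = i" "s ''r'' 0 = r" and A': "filtering f m A' s"
      "A' \<subseteq> A" "stable f A \<longrightarrow> A' = A"
      "A' = A \<longrightarrow> i \<in> A \<longrightarrow> (\<forall>w<v. adj (fst (f i)) w \<longrightarrow> supported f A i w)"
      unfolding I_def by blast
    show ?thesis
    proof (rule runs_Seq, rule runs_mono[OF find_support[OF assms(2,3) A'(1) assms(5) s(1) v]])
      fix s'
      assume *: "(\<forall>x. x \<notin> {''c'', ''found'', ''j''} \<longrightarrow> s' x = s x) \<and>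
        s' ''found'' 0 = of_bool (supported f A' i v)"
      then have filt: "filtering f m A' s'" using filtering_cong[OF conjunct1[OF *]] A'(1) by simp
      have s': "s' ''i'' 0 = i" "s' ''r'' 0 = r" "s' ''v'' 0 = v" using * s v by simp_all
      have "f i \<in> cands" using filt assms(5) by (auto simp: filtering_def bij_betw_def)
      then have "fst (f i) < n" by (auto simp: cands_def)
      then have adj: "s' ''adj'' (s' ''muln'' (s' ''owner'' i) + v) = of_bool (adj (fst (f i)) v)"
        using filt assms(5) \<open>v < n\<close> by (simp add: filtering_def table_def inputs_def)
      show "runs W (If (And (Less (Const 0) (Get ''adj'' (Add (Get ''muln'' (Get ''owner'' (var ''i''))) (var ''v''))))
              (Less (var ''found'') (Const 1)))
       (Put ''dead'' (var ''i'') (Const 1)) Skip) s' (\<lambda>s'. s' ''v'' 0 = v \<and> I (Suc v) s')"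
      proof (rule runs_If)
        assume "bval (And (Less (Const 0) (Get ''adj'' (Add (Get ''muln'' (Get ''owner'' (var ''i''))) (var ''v''))))
              (Less (var ''found'') (Const 1))) s'"
        then have kill: "adj (fst (f i)) v" "\<not> supported f A' i v"
          using adj * s' by auto
        have "covers f A'" using filt by (simp add: filtering_def)
        then have "covers f (A' - {i})" by (rule covers_remove[of f A' v i, OF _ \<open>v < n\<close> kill])
        then have "filtering f m (A' - {i}) (s'(''dead'' := (s' ''dead'')(i := 1)))"
          using filt by (auto simp: filtering_def inputs_def table_def)
        \<comment> \<open>For stable \<open>A\<close> we have \<open>A' = A\<close>, and the missing
          support shows that \<open>i\<close> was not in \<open>A\<close>; marking it as dead again
          changes nothing.\<close>
        moreover have "stable f A \<longrightarrow> A' - {i} = A"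
          using A'(3) kill \<open>v < n\<close> by (auto simp: stable_def)
        moreover have "A' - {i} = A \<longrightarrow> i \<notin> A" by auto
        ultimately show "runs W (Put ''dead'' (var ''i'') (Const 1)) s' (\<lambda>s'. s' ''v'' 0 = v \<and> I (Suc v) s')"
          using s' A'(2) unfolding I_def
          by (intro runs_Put conjI exI[of _ "A' - {i}"]) (simp_all, blast)
      next
        assume "\<not> bval (And (Less (Const 0) (Get ''adj'' (Add (Get ''muln'' (Get ''owner'' (var ''i''))) (var ''v''))))
              (Less (var ''found'') (Const 1))) s'"
        then have "adj (fst (f i)) v \<longrightarrow> supported f A' i v" using adj * s' by auto
        then have "A' = A \<longrightarrow> i \<in> A \<longrightarrow> (\<forall>w<Suc v. adj (fst (f i)) w \<longrightarrow> supported f A i w)"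
          using A'(4) by (metis less_SucE)
        then have "I (Suc v) s'" using s' filt A'(2,3) unfolding I_def by blast
        then show "runs W Skip s' (\<lambda>s'. s' ''v'' 0 = v \<and> I (Suc v) s')"
          using s' by (intro runs_Skip conjI)
      qed
    qed
  qed
  show ?thesis unfolding filter_candidate_def
    apply (rule runs_For[where I = I and N = n, OF assms(1) \<open>I 0 s\<close> _ _ step])
       apply (simp add: I_def)
      apply (auto simp: I_def filtering_def inputs_def)[1]
     apply assumption+
    apply (simp add: I_def)
    done
qed

text \<open>Sets only shrink, so if the round ends with \<open>A\<close> then every intermediate set
  was \<open>A\<close>, and each candidate was tested against \<open>A\<close> itself.\<close>

lemma filter_round:
  assumes "n \<le> W" "k \<le> W" "card cands \<le> W" "filtering f m A s" "s ''r'' 0 = r"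
  shows "runs W (For ''i'' ''m'' filter_candidate) s (\<lambda>s'. s' ''r'' 0 = r \<and>
    (\<exists>A'. filtering f m A' s' \<and> A' \<subseteq> A \<and> (stable f A \<longrightarrow> A' = A) \<and> (A' = A \<longrightarrow> stable f A)))"
proof -
  define I where "I = (\<lambda>i s'. s' ''r'' 0 = r \<and>
    (\<exists>A'. filtering f m A' s' \<and> A' \<subseteq> A \<and> (stable f A \<longrightarrow> A' = A) \<and>
       (A' = A \<longrightarrow> (\<forall>j\<in>A. j < i \<longrightarrow> (\<forall>v<n. adj (fst (f j)) v \<longrightarrow> supported f A j v)))))"
  have "I 0 s" using assms by (auto simp: I_def)
  have "m = card cands" using assms(4) bij_betw_same_card by (fastforce simp: filtering_def)
  with assms have "m \<le> W" by simp
  have "A \<subseteq> {..<m}" using assms(4) by (simp add: filtering_def)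
  have step: "runs W filter_candidate s (\<lambda>s'. s' ''i'' 0 = i \<and> I (Suc i) s')"
    if "i < m" "I i s" "s ''i'' 0 = i" for i s
  proof -
    from \<open>I i s\<close> obtain A' where s: "s ''r'' 0 = r" and A': "filtering f m A' s"
      "A' \<subseteq> A" "stable f A \<longrightarrow> A' = A"
      "A' = A \<longrightarrow> (\<forall>j\<in>A. j < i \<longrightarrow> (\<forall>v<n. adj (fst (f j)) v \<longrightarrow> supported f A j v))"
      unfolding I_def by blast
    show ?thesis
    proof (rule runs_mono[OF filter_candidate[OF assms(1-3) A'(1) \<open>i < m\<close> \<open>s ''i'' 0 = i\<close> s]], elim conjE exE)
      fix s' A'' assume *: "s' ''i'' 0 = i" "s' ''r'' 0 = r" "filtering f m A'' s'" "A'' \<subseteq> A'"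
        "stable f A' \<longrightarrow> A'' = A'"
        "A'' = A' \<longrightarrow> i \<in> A' \<longrightarrow> (\<forall>v<n. adj (fst (f i)) v \<longrightarrow> supported f A' i v)"
      have "A'' = A \<longrightarrow> A' = A" using *(4) A'(2) by blast
      then have "A'' = A \<longrightarrow> (\<forall>j\<in>A. j < Suc i \<longrightarrow> (\<forall>v<n. adj (fst (f j)) v \<longrightarrow> supported f A j v))"
        using *(6) A'(4) by (metis less_SucE)
      moreover have "A'' \<subseteq> A" using *(4) A'(2) by (rule subset_trans)
      moreover have "stable f A \<longrightarrow> A'' = A" using *(5) A'(3) by metis
      ultimately show "s' ''i'' 0 = i \<and> I (Suc i) s'" using *(1-3) unfolding I_def by blast
    qed
  qed
  show ?thesis
    apply (rule runs_For[where I = I and N = m, OF \<open>m \<le> W\<close> \<open>I 0 s\<close> _ _ step])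
       apply (simp add: I_def)
      apply (auto simp: I_def filtering_def table_def)[1]
     apply assumption+
    subgoal for s
    proof -
      assume "I m s"
      then obtain A' where A': "s ''r'' 0 = r" "filtering f m A' s" "A' \<subseteq> A" "stable f A \<longrightarrow> A' = A"
        "A' = A \<longrightarrow> (\<forall>j\<in>A. j < m \<longrightarrow> (\<forall>v<n. adj (fst (f j)) v \<longrightarrow> supported f A j v))"
        unfolding I_def by blast
      have "A' = A \<longrightarrow> stable f A"
        using A'(5) \<open>A \<subseteq> {..<m}\<close> unfolding stable_def by auto
      with A' show ?thesis by blast
    qed
    done
qed

text \<open>Each round starting from an unstable set deletes a candidate, so
  \<open>card A + r <= m\<close> persists until stability is reached.\<close>

lemma filter_all:
  assumes "n \<le> W" "k \<le> W" "card cands \<le> W" "filtering f m A s"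
  shows "runs W filter_all s (\<lambda>s'. \<exists>A'. filtering f m A' s' \<and> stable f A')"
proof -
  define I where "I = (\<lambda>r s. \<exists>A. filtering f m A s \<and> (stable f A \<or> card A + r \<le> m))"
  have fin: "finite A" "card A \<le> m" if "filtering f m A s" for A s
  proof -
    have "A \<subseteq> {..<m}" using that by (simp add: filtering_def)
    then show "finite A" "card A \<le> m" using card_mono[of "{..<m}" A] by (auto intro: finite_subset)
  qed
  have "I 0 s" using assms(4) fin by (auto simp: I_def)
  have "m = card cands" using assms(4) bij_betw_same_card by (fastforce simp: filtering_def)
  with assms have "m \<le> W" by simp
  have step: "runs W (For ''i'' ''m'' filter_candidate) s (\<lambda>s'. s' ''r'' 0 = r \<and> I (Suc r) s')"
    if "r < m" "I r s" "s ''r'' 0 = r" for r s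
  proof -
    from \<open>I r s\<close> obtain A where A: "filtering f m A s" "stable f A \<or> card A + r \<le> m"
      unfolding I_def by blast
    show ?thesis
    proof (rule runs_mono[OF filter_round[OF assms(1-3) A(1) \<open>s ''r'' 0 = r\<close>]], elim conjE exE)
      fix s' A' assume *: "s' ''r'' 0 = r" "filtering f m A' s'" "A' \<subseteq> A" "stable f A \<longrightarrow> A' = A"
        "A' = A \<longrightarrow> stable f A"
      have "card A' < card A" if "A' \<noteq> A"
        using *(3) that fin(1)[OF A(1)] by (simp add: psubset_card_mono psubsetI)
      then have "stable f A' \<or> card A' + Suc r \<le> m" using * A(2) by fastforce
      with * show "s' ''r'' 0 = r \<and> I (Suc r) s'" unfolding I_def by blast
    qed
  qed
  show ?thesis unfolding filter_all_def
    apply (rule runs_For[where I = I and N = m, OF \<open>m \<le> W\<close> \<open>I 0 s\<close> _ _ step])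
       apply (simp add: I_def)
      apply (auto simp: I_def filtering_def table_def)[1]
     apply assumption+
    subgoal for s
    proof -
      assume "I m s"
      then obtain A where A: "filtering f m A s" "stable f A \<or> card A + m \<le> m" unfolding I_def by blast
      \<comment> \<open>After \<open>m\<close> rounds without reaching stability the counting bound
        leaves only the empty set, which is itself stable.\<close>
      have "stable f {}" by (simp add: stable_def)
      then have "stable f A" using A fin(1)[OF A(1)] by auto
      with A show ?thesis by blast
    qed
    done
qed

lemma read_result:
  assumes "card cands \<le> W" "0 < n" "filtering f m A s" "stable f A"
  shows "runs W read_result s (\<lambda>s. s ''result'' 0 = of_bool (\<exists>X S. consistent X \<and> (0, S) \<in> X))"
proof -
  define I where "I = (\<lambda>i s. table f m s \<and> (\<forall>j<m. s ''dead'' j = of_bool (j \<notin> A)) \<and>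
    s ''result'' 0 = of_bool (\<exists>j<i. j \<in> A \<and> fst (f j) = 0))"
  have "I 0 s" using assms by (simp add: I_def filtering_def)
  have "m = card cands" using assms(3) bij_betw_same_card by (fastforce simp: filtering_def)
  with assms have "m \<le> W" by simp
  have A: "A \<subseteq> {..<m}" "covers f A" "f ` {..<m} = cands"
    using assms(3) by (simp_all add: filtering_def bij_betw_def)
  have cons: "consistent (f ` A)"
    unfolding consistent_def
  proof (intro conjI ballI)
    show "f ` A \<subseteq> cands" using A by auto
    fix p assume "p \<in> f ` A"
    then obtain i where i: "i \<in> A" "p = f i" by blast
    have "\<exists>S'. (v, S') \<in> f ` A \<and> snd p \<inter> S' \<noteq> {}" if v: "v < n" "adj (fst p) v" for v
    proof -
      from i v assms(4) obtain j where "j \<in> A" "fst (f j) = v" "snd p \<inter> snd (f j) \<noteq> {}"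
        unfolding stable_def supported_def by blast
      then show ?thesis by (intro exI[of _ "snd (f j)"]) force
    qed
    then show "case p of (u, S) \<Rightarrow> \<forall>v<n. adj u v \<longrightarrow> (\<exists>S'. (v, S') \<in> f ` A \<and> S \<inter> S' \<noteq> {})"
      by (simp add: split_beta)
  qed
  have iff: "(\<exists>j<m. j \<in> A \<and> fst (f j) = 0) \<longleftrightarrow> (\<exists>X S. consistent X \<and> (0, S) \<in> X)"
  proof
    assume "\<exists>j<m. j \<in> A \<and> fst (f j) = 0"
    then obtain j where "j \<in> A" "fst (f j) = 0" by blast
    then have "(0, snd (f j)) \<in> f ` A" by (force simp: image_iff prod_eq_iff)
    with cons show "\<exists>X S. consistent X \<and> (0, S) \<in> X" by blast
  next
    assume "\<exists>X S. consistent X \<and> (0, S) \<in> X"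
    then obtain S where "(0, S) \<in> f ` A" using A(2) unfolding covers_def by blast
    then obtain j where "j \<in> A" "(0, S) = f j" by blast
    then have "fst (f j) = 0" by (metis fst_conv)
    with A(1) \<open>j \<in> A\<close> show "\<exists>j<m. j \<in> A \<and> fst (f j) = 0" by blast
  qed
  show ?thesis unfolding read_result_def
    apply (rule runs_For[where I = I and N = m, OF \<open>m \<le> W\<close> \<open>I 0 s\<close>])
       apply (simp add: I_def)
      apply (simp add: I_def table_def)
     apply (rule runs_If)
      apply (rule runs_Put)
    subgoal for i s by (auto simp: I_def table_def less_Suc_eq)
     apply (rule runs_Skip)
    subgoal for i s by (auto simp: I_def table_def less_Suc_eq)
    apply (simp add: I_def iff)
    done
qed

text \<open>The bounds on \<open>W\<close> are conditional because for \<open>k = 0\<close> the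
  intended \<open>W\<close> is 1 while \<open>n\<close> is arbitrary; that branch has no
  loop.\<close>

lemma decide_connectable:
  assumes "k > 0 \<Longrightarrow> n \<le> W" "k > 0 \<Longrightarrow> k \<le> W" "k > 0 \<Longrightarrow> card cands \<le> W" "0 < n" "inputs s"
    "\<forall>x. x \<notin> {''n'', ''k'', ''budget'', ''spec'', ''adj''} \<longrightarrow> s x = (\<lambda>_. 0)"
  shows "runs W decide_connectable s (\<lambda>s. s ''result'' 0 =
    of_bool (if k = 0 then n = 1 else \<exists>X S. consistent X \<and> (0, S) \<in> X))"
  unfolding decide_connectable_def
proof (rule runs_If)
  have nk: "s ''n'' 0 = n" "s ''k'' 0 = k" using assms(5) by (simp_all add: inputs_def)
  {
    assume "bval (Less (Const 0) (var ''k'')) s"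
    then have "0 < k" using nk by simp
    note W = assms(1-3)[OF this]
    have alive: "all_alive s" using assms(6) by (simp add: all_alive_def)
    \<comment> \<open>Initially every candidate is alive, and consistent sets consist of candidates
      by definition.\<close>
    have start: "filtering f m {..<m} s'"
      if "inputs s'" "all_alive s'" "table f m s'" "bij_betw f {..<m} cands" for f m s'
      using that by (auto simp: filtering_def all_alive_def covers_def consistent_def bij_betw_def)
    have "runs W (Seq generate (Seq filter_all read_result)) s
       (\<lambda>s. s ''result'' 0 = of_bool (\<exists>X S. consistent X \<and> (0, S) \<in> X))"
      apply (rule runs_Seq, rule runs_mono[OF generate[OF W assms(5) alive]])
      using assms(6) apply simp
      apply (elim conjE exE)
      apply (rule runs_Seq, rule runs_mono[OF filter_all[OF W start]], assumption+)
      apply (elim conjE exE)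
      apply (rule read_result[OF W(3) assms(4)], assumption+)
      done
    then show "runs W (Seq generate (Seq filter_all read_result)) s (\<lambda>s. s ''result'' 0 =
      of_bool (if k = 0 then n = 1 else \<exists>X S. consistent X \<and> (0, S) \<in> X))"
      using \<open>0 < k\<close> by simp
  next
    assume "\<not> bval (Less (Const 0) (var ''k'')) s"
    \<comment> \<open>Subtraction is truncated, so for positive \<open>n\<close> the value
      \<open>2 - n\<close> is 1 if \<open>n = 1\<close> and 0 otherwise.\<close>
    then show "runs W (assign ''result'' (Sub (Const 2) (var ''n''))) s (\<lambda>s. s ''result'' 0 =
      of_bool (if k = 0 then n = 1 else \<exists>X S. consistent X \<and> (0, S) \<in> X))"
      using nk assms(4) by (intro runs_Put) auto
  }
qed

end


section \<open>Trees\<close>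

text \<open>A path is extended edge by edge; when it would return to a visited vertex, it is cut
  back to that vertex. The bound on \<open>set vs\<close> later keeps a path inside a given vertex
  set.\<close>

lemma rtrancl_simple_path:
  assumes "(x, y) \<in> {(a, b). {a, b} \<in> F}\<^sup>*"
  obtains vs where "vs \<noteq> []" "distinct vs" "hd vs = x" "last vs = y"
    "successively (\<lambda>a b. {a, b} \<in> F) vs" "set vs \<subseteq> insert x (\<Union>F)"
proof -
  from assms have "\<exists>vs. vs \<noteq> [] \<and> distinct vs \<and> hd vs = x \<and> last vs = y \<and>
    successively (\<lambda>a b. {a, b} \<in> F) vs \<and> set vs \<subseteq> insert x (\<Union>F)"
  proof (induction rule: rtrancl_induct)
    case base
    show ?case by (rule exI[of _ "[x]"]) simp
  next
    case (step y z)
    then obtain vs where vs: "vs \<noteq> []" "distinct vs" "hd vs = x" "last vs = y"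
      "successively (\<lambda>a b. {a, b} \<in> F) vs" "set vs \<subseteq> insert x (\<Union>F)" by blast
    have yz: "{y, z} \<in> F" using step.hyps by simp
    show ?case
    proof (cases "z \<in> set vs")
      case True
      then obtain as bs where split: "vs = (as @ [z]) @ bs" by (metis split_list append.assoc append_Cons append_Nil)
      have "hd (as @ [z]) = x" using vs(3) split by (cases as) auto
      with vs split show ?thesis
        by (intro exI[of _ "as @ [z]"]) (auto simp: successively_append_iff)
    next
      case False
      with vs yz show ?thesis
        by (intro exI[of _ "vs @ [z]"]) (auto simp: successively_append_iff)
    qed
  qed
  with that show thesis by blast
qed

lemma graph_cycle_closing_edge:
  assumes "length vs \<ge> 3" "distinct vs" "successively (\<lambda>a b. {a, b} \<in> E) vs" "{last vs, hd vs} \<in> E"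
  shows "graph_cycle E vs"
  using assms by (auto simp: graph_cycle_def successively_conv_nth)

lemma simple_graph_edge:
  assumes "simple_graph V E" "{u, v} \<in> E"
  shows "u \<in> V" "v \<in> V" "u \<noteq> v"
  using assms by (auto simp: simple_graph_def)

text \<open>An unrealized potential edge would close a cycle with a path in the realization graph.\<close>

lemma connectable_tree_iff:
  assumes tree: "tree_graph (users N) (potential_edges N)"
  shows "connectable N \<longleftrightarrow>
    (\<exists>SA. spectrum_assignment N SA \<and> (\<forall>u v. {u, v} \<in> potential_edges N \<longrightarrow> SA u \<inter> SA v \<noteq> {}))"
proof
  assume "connectable N"
  then obtain SA where SA: "spectrum_assignment N SA" "connected_graph (users N) (realized_edges N SA)"
    unfolding connectable_def by blast
  have "SA u \<inter> SA v \<noteq> {}" if uv: "{u, v} \<in> potential_edges N" for u v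
  proof
    assume disjoint: "SA u \<inter> SA v = {}"
    have u: "u \<in> users N" "v \<in> users N" "u \<noteq> v"
      using simple_graph_edge uv tree unfolding tree_graph_def by metis+
    with SA(2) have "(u, v) \<in> {(a, b). {a, b} \<in> realized_edges N SA}\<^sup>*"
      unfolding connected_graph_def by blast
    then obtain vs where vs: "vs \<noteq> []" "distinct vs" "hd vs = u" "last vs = v"
      "successively (\<lambda>a b. {a, b} \<in> realized_edges N SA) vs"
      by (rule rtrancl_simple_path)
    have sub: "realized_edges N SA \<subseteq> potential_edges N" by (auto simp: realized_edges_def)
    have "{u, v} \<notin> realized_edges N SA"
      using disjoint by (auto simp: realized_edges_def doubleton_eq_iff)
    \<comment> \<open>Excluding one and two vertices leaves the three that a cycle requires.\<close>
    then have "vs \<noteq> [u, v]" using vs(5) by auto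
    moreover have "vs \<noteq> [w]" for w using vs u(3) by auto
    ultimately have "length vs \<ge> 3"
      using vs(1,3,4) by (cases vs; cases "tl vs"; cases "tl (tl vs)") auto
    moreover have "successively (\<lambda>a b. {a, b} \<in> potential_edges N) vs"
      using vs(5) by (rule successively_mono) (use sub in auto)
    moreover have "{last vs, hd vs} \<in> potential_edges N" using uv vs(3,4) by (simp add: insert_commute)
    ultimately have "graph_cycle (potential_edges N) vs" using vs(2) graph_cycle_closing_edge by blast
    with tree show False unfolding tree_graph_def by blast
  qed
  with SA(1) show "\<exists>SA. spectrum_assignment N SA \<and> (\<forall>u v. {u, v} \<in> potential_edges N \<longrightarrow> SA u \<inter> SA v \<noteq> {})"
    by blast
next
  assume "\<exists>SA. spectrum_assignment N SA \<and> (\<forall>u v. {u, v} \<in> potential_edges N \<longrightarrow> SA u \<inter> SA v \<noteq> {})"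
  then obtain SA where SA: "spectrum_assignment N SA"
    "\<And>u v. {u, v} \<in> potential_edges N \<Longrightarrow> SA u \<inter> SA v \<noteq> {}" by blast
  have "{u, v} \<in> realized_edges N SA \<longleftrightarrow> {u, v} \<in> potential_edges N" for u v
    using SA(2)[of u v] unfolding realized_edges_def by auto
  then have "connected_graph (users N) (realized_edges N SA)"
    using tree by (simp add: tree_graph_def connected_graph_def)
  with SA(1) show "connectable N" unfolding connectable_def by blast
qed

text \<open>Take a maximal vertex set that contains \<open>r\<close>, is connected within itself and
  carries a partial solution. Acyclicity allows a vertex outside it at most one neighbour inside, so
  arc consistency can always extend the solution.\<close>

lemma tree_arc_consistent_solvable:
  assumes tree: "tree_graph V E" and "finite V" and r: "r \<in> V" "x \<in> D r"
    and arc: "\<And>u v x. {u, v} \<in> E \<Longrightarrow> x \<in> D u \<Longrightarrow> \<exists>y\<in>D v. R x y"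
    and sym: "\<And>x y. R x y \<Longrightarrow> R y x"
  shows "\<exists>f. (\<forall>v\<in>V. f v \<in> D v) \<and> (\<forall>u v. {u, v} \<in> E \<longrightarrow> R (f u) (f v))"
proof -
  \<comment> \<open>Only edges inside \<open>W\<close> are allowed, so that connecting paths avoid
    the vertex to be added.\<close>
  define reach where "reach = (\<lambda>W. {(a, b). {a, b} \<in> {e \<in> E. e \<subseteq> W}}\<^sup>*)"
  define P where "P = (\<lambda>W. r \<in> W \<and> W \<subseteq> V \<and> (\<forall>v\<in>W. (r, v) \<in> reach W) \<and>
    (\<exists>f. (\<forall>v\<in>W. f v \<in> D v) \<and> (\<forall>u\<in>W. \<forall>v\<in>W. {u, v} \<in> E \<longrightarrow> R (f u) (f v))))"
  have simple: "simple_graph V E" using tree by (simp add: tree_graph_def)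
  have reach_sym: "(b, a) \<in> reach W" if "(a, b) \<in> reach W" for a b W
    using that unfolding reach_def
    by (rule symD[OF sym_rtrancl, rotated]) (auto simp: sym_def insert_commute)
  \<comment> \<open>Without loops the edge condition on the starting set \<open>{r}\<close> is
    vacuous.\<close>
  have "{r} \<notin> E" using simple by (auto simp: simple_graph_def)
  then have "P {r}"
    unfolding P_def reach_def
    using r by (auto intro!: exI[of _ "\<lambda>_. x"])
  moreover have "finite {W. P W}"
    by (rule finite_subset[of _ "Pow V"]) (auto simp: P_def \<open>finite V\<close>)
  ultimately obtain W where W_max: "W \<in> {W. P W}" "\<forall>W'\<in>{W. P W}. W \<subseteq> W' \<longrightarrow> W = W'"
    using finite_has_maximal[of "{W. P W}"] by auto
  from W_max(1) obtain f where *: "r \<in> W" "W \<subseteq> V" "\<forall>v\<in>W. (r, v) \<in> reach W"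
    "\<forall>v\<in>W. f v \<in> D v" "\<forall>u\<in>W. \<forall>v\<in>W. {u, v} \<in> E \<longrightarrow> R (f u) (f v)"
    unfolding P_def by blast
  from *(1-3) have W: "r \<in> W" "W \<subseteq> V" "\<And>v. v \<in> W \<Longrightarrow> (r, v) \<in> reach W" by blast+
  from *(4,5) have f: "\<And>v. v \<in> W \<Longrightarrow> f v \<in> D v"
    "\<And>u v. u \<in> W \<Longrightarrow> v \<in> W \<Longrightarrow> {u, v} \<in> E \<Longrightarrow> R (f u) (f v)" by blast+
  have "W = V"
  proof (rule ccontr)
    assume "W \<noteq> V"
    with W(2) obtain v where "v \<in> V" "v \<notin> W" by blast
    have "(r, v) \<in> {(a, b). {a, b} \<in> E}\<^sup>*"
      using tree r(1) \<open>v \<in> V\<close> unfolding tree_graph_def connected_graph_def by blast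
    \<comment> \<open>A path from \<open>r\<close> to a vertex outside \<open>W\<close> must cross
      the boundary along some edge.\<close>
    then have "v \<notin> W \<longrightarrow> (\<exists>a b. a \<in> W \<and> b \<notin> W \<and> {a, b} \<in> E)"
      by (induction rule: rtrancl_induct) (use W(1) in auto)
    with \<open>v \<notin> W\<close> obtain a b where ab: "a \<in> W" "b \<notin> W" "{a, b} \<in> E" by blast
    \<comment> \<open>Two neighbours of \<open>b\<close> in \<open>W\<close> are joined by a path
      inside \<open>W\<close>, which \<open>b\<close> would close to a cycle.\<close>
    have unique: "w = a" if w: "w \<in> W" "{w, b} \<in> E" for w
    proof (rule ccontr)
      assume "w \<noteq> a"
      have "(a, w) \<in> reach W"
        using reach_sym[OF W(3)[OF ab(1)]] W(3)[OF w(1)] unfolding reach_def by (rule rtrancl_trans)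
      then obtain vs where vs: "vs \<noteq> []" "distinct vs" "hd vs = a" "last vs = w"
        "successively (\<lambda>a b. {a, b} \<in> {e \<in> E. e \<subseteq> W}) vs" "set vs \<subseteq> insert a (\<Union>{e \<in> E. e \<subseteq> W})"
        unfolding reach_def by (rule rtrancl_simple_path)
      have "b \<notin> set vs" using vs(6) ab by auto
      moreover have "vs \<noteq> [c]" for c using vs(3,4) \<open>w \<noteq> a\<close> by auto
      then have "length (vs @ [b]) \<ge> 3" using vs(1) by (cases vs; cases "tl vs") auto
      moreover have "successively (\<lambda>a b. {a, b} \<in> E) vs"
        using vs(5) by (rule successively_mono) auto
      then have "successively (\<lambda>a b. {a, b} \<in> E) (vs @ [b])"
        using w(2) vs(1,4) by (simp add: successively_append_iff)
      moreover have "{last (vs @ [b]), hd (vs @ [b])} \<in> E"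
        using ab(3) vs(1,3) by (simp add: insert_commute)
      ultimately have "graph_cycle E (vs @ [b])" using vs(2) by (intro graph_cycle_closing_edge) auto
      with tree show False unfolding tree_graph_def by blast
    qed
    obtain y where y: "y \<in> D b" "R (f a) y" using arc[OF ab(3) f(1)[OF ab(1)]] by blast
    define f' where "f' = f(b := y)"
    have "P (insert b W)"
      unfolding P_def
    proof (intro conjI exI[of _ f'] ballI impI)
      show "r \<in> insert b W" using W(1) by simp
      show "insert b W \<subseteq> V" using W(2) simple_graph_edge(2)[OF simple ab(3)] by simp
      have mono: "reach W \<subseteq> reach (insert b W)" unfolding reach_def by (rule rtrancl_mono) auto
      have "(a, b) \<in> reach (insert b W)"
        unfolding reach_def using ab by (intro r_into_rtrancl) auto
      then have "(r, b) \<in> reach (insert b W)"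
        using mono W(3)[OF ab(1)] unfolding reach_def by (meson rtrancl_trans subsetD)
      then show "(r, v) \<in> reach (insert b W)" if "v \<in> insert b W" for v
        using that W(3) mono by blast
      show "f' v \<in> D v" if "v \<in> insert b W" for v using that f(1) y by (auto simp: f'_def)
      show "R (f' u) (f' v)" if uv: "u \<in> insert b W" "v \<in> insert b W" "{u, v} \<in> E" for u v
      proof -
        have "u \<noteq> v" using simple_graph_edge(3)[OF simple uv(3)] .
        then consider "u \<in> W" "v \<in> W" "u \<noteq> b" "v \<noteq> b" | "u = b" "v \<in> W" "v \<noteq> b" | "v = b" "u \<in> W" "u \<noteq> b"
          using uv ab(2) by blast
        then show ?thesis
        proof cases
          case 1
          then show ?thesis using f(2) uv(3) by (simp add: f'_def)
        next
          case 2
          then have "v = a" using unique uv(3) by (simp add: insert_commute)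
          then show ?thesis using 2 y(2) sym by (simp add: f'_def)
        next
          case 3
          then have "u = a" using unique uv(3) by simp
          then show ?thesis using 3 y(2) by (simp add: f'_def)
        qed
      qed
    qed
    with W_max(2) ab(2) show False by auto
  qed
  with f simple_graph_edge[OF simple] show ?thesis by blast
qed


section \<open>Indexed networks\<close>

lemma array_append: "array (xs @ ys) i = (if i < length xs then xs ! i else array ys (i - length xs))"
  by (auto simp: array_def nth_append)

lemma array_concat_rows:
  assumes "\<forall>x\<in>set xs. length (g x) = l" "i < length xs" "j < l"
  shows "array (concat (map g xs)) (i * l + j) = g (xs ! i) ! j"
  using assms
proof (induction xs arbitrary: i)
  case (Cons x xs)
  then show ?case
    by (cases i) (simp_all add: array_append)
qed simp

context
  fixes N :: "('u, 'c) network" and us cs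
  assumes network: "cognitive_radio_network N"
    and tree: "tree_graph (users N) (potential_edges N)"
    and us: "enumerates us (users N)" and cs: "enumerates cs (channels N)"
begin

abbreviation "num_users \<equiv> length us"
abbreviation "num_channels \<equiv> length cs"
abbreviation "index_spec \<equiv> \<lambda>u c. cs ! c \<in> spec_map N (us ! u)"
abbreviation "index_adj \<equiv> \<lambda>u v. {us ! u, us ! v} \<in> potential_edges N"
abbreviation "index_budget \<equiv> \<lambda>u. budget N (us ! u)"

interpretation search_space num_users num_channels W index_spec index_adj index_budget for W .

lemma user_index: "u \<in> users N \<longleftrightarrow> (\<exists>i<num_users. u = us ! i)"
  using us unfolding enumerates_def by (metis in_set_conv_nth)

lemma num_users_pos: "0 < num_users"
  using tree user_index unfolding tree_graph_def connected_graph_def by fastforce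

lemma inj_cs: "inj_on (nth cs) {..<num_channels}"
  using cs unfolding enumerates_def by (simp add: inj_on_nth)

lemma finite_spec_map: "i < num_users \<Longrightarrow> finite (spec_map N (us ! i))"
  using network user_index unfolding cognitive_radio_network_def by (metis finite_subset)

lemma inputs_input_store: "inputs (input_store N us cs)"
  unfolding inputs_def input_store_def
  by (simp add: array_concat_rows) (simp add: array_def)

lemma card_spec_le: "i < num_users \<Longrightarrow> card {c. c < num_channels \<and> index_spec i c} \<le> max_spec N"
proof -
  assume i: "i < num_users"
  have "card {c. c < num_channels \<and> index_spec i c} \<le> card (spec_map N (us ! i))"
    by (rule card_inj_on_le[of "nth cs"])
      (use inj_cs finite_spec_map[OF i] in \<open>auto elim: inj_on_subset\<close>)
  also have "\<dots> \<le> max_spec N"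
    unfolding max_spec_def using network user_index i
    by (intro Max_ge) (auto simp: cognitive_radio_network_def)
  finally show ?thesis .
qed

lemma max_spec_le: "max_spec N \<le> num_channels"
proof -
  have "card (channels N) = num_channels" using cs unfolding enumerates_def by (metis distinct_card)
  moreover have "users N \<noteq> {}" using tree unfolding tree_graph_def connected_graph_def by blast
  ultimately show ?thesis
    unfolding max_spec_def using network
    by (auto simp: cognitive_radio_network_def) (metis card_mono)
qed

text \<open>Each user contributes at most all subsets of its available channels, that is, at most 2
  to the power \<open>max_spec N\<close>.\<close>

lemma card_cands_le: "card cands \<le> num_users * 2 ^ max_spec N"
proof -
  let ?S = "\<lambda>i. {c. c < num_channels \<and> index_spec i c}"
  have "cands \<subseteq> Sigma {..<num_users} (\<lambda>i. Pow (?S i))" by (auto simp: cands_def)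
  then have "card cands \<le> card (Sigma {..<num_users} (\<lambda>i. Pow (?S i)))"
    by (intro card_mono) auto
  also have "\<dots> = (\<Sum>i<num_users. 2 ^ card (?S i))" by (simp add: card_Pow)
  also have "\<dots> \<le> (\<Sum>i<num_users. 2 ^ max_spec N)"
    by (intro sum_mono power_increasing card_spec_le) auto
  finally show ?thesis by simp
qed

text \<open>An assignment realizing all edges is a consistent set with one candidate per user.
  Conversely, the sets in \<open>X\<close> are arc consistent domains, and the entry for user 0
  makes the root's domain nonempty.\<close>

lemma connectable_iff_consistent: "connectable N \<longleftrightarrow> (\<exists>X S. consistent X \<and> (0, S) \<in> X)"
proof
  assume "connectable N"
  then obtain SA where SA: "spectrum_assignment N SA"
    "\<And>u v. {u, v} \<in> potential_edges N \<Longrightarrow> SA u \<inter> SA v \<noteq> {}"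
    using connectable_tree_iff[OF tree] by blast
  define F where "F = (\<lambda>i. {c. c < num_channels \<and> cs ! c \<in> SA (us ! i)})"
  have SA_sub: "SA (us ! i) \<subseteq> spec_map N (us ! i)" "card (SA (us ! i)) \<le> index_budget i"
    if "i < num_users" for i
    using SA(1) user_index that unfolding spectrum_assignment_def by blast+
  have "(i, F i) \<in> cands" if i: "i < num_users" for i
  proof -
    have "card (F i) \<le> card (SA (us ! i))"
      by (rule card_inj_on_le[of "nth cs"])
        (use inj_cs finite_subset[OF SA_sub(1) finite_spec_map] i in \<open>auto simp: F_def elim: inj_on_subset\<close>)
    with SA_sub[OF i] i show ?thesis by (auto simp: cands_def F_def)
  qed
  moreover have "F i \<inter> F j \<noteq> {}" if ij: "i < num_users" "index_adj i j" for i j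
  proof -
    from SA(2)[OF ij(2)] obtain ch where ch: "ch \<in> SA (us ! i)" "ch \<in> SA (us ! j)" by blast
    then have "ch \<in> channels N"
      using SA_sub(1)[OF ij(1)] network user_index ij(1) unfolding cognitive_radio_network_def by blast
    then obtain c where "c < num_channels" "ch = cs ! c"
      using cs unfolding enumerates_def by (metis in_set_conv_nth)
    with ch show ?thesis by (auto simp: F_def)
  qed
  ultimately have "consistent {(i, F i) | i. i < num_users}" unfolding consistent_def by auto
  with num_users_pos show "\<exists>X S. consistent X \<and> (0, S) \<in> X" by blast
next
  assume "\<exists>X S. consistent X \<and> (0, S) \<in> X"
  then obtain X S where X: "consistent X" "(0, S) \<in> X" by blast
  then have cand: "\<And>i S. (i, S) \<in> X \<Longrightarrow> (i, S) \<in> cands" unfolding consistent_def by blast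
  \<comment> \<open>The candidates in \<open>X\<close>, translated from indices back to channels,
    become the domains of the actual users.\<close>
  define D where "D = (\<lambda>u. {nth cs ` S | i S. (i, S) \<in> X \<and> us ! i = u})"
  have "\<exists>f. (\<forall>v\<in>users N. f v \<in> D v) \<and> (\<forall>u v. {u, v} \<in> potential_edges N \<longrightarrow> f u \<inter> f v \<noteq> {})"
  proof (rule tree_arc_consistent_solvable[OF tree])
    show "finite (users N)" using network by (simp add: cognitive_radio_network_def)
    show "us ! 0 \<in> users N" using user_index num_users_pos by blast
    show "nth cs ` S \<in> D (us ! 0)" using X(2) unfolding D_def by blast
    fix u v A assume uv: "{u, v} \<in> potential_edges N" and "A \<in> D u"
    then obtain i S where i: "A = nth cs ` S" "(i, S) \<in> X" "us ! i = u" unfolding D_def by blast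
    have "v \<in> users N" using simple_graph_edge(2) tree uv unfolding tree_graph_def by metis
    then obtain j where j: "j < num_users" "v = us ! j" using user_index by blast
    then obtain S' where "(j, S') \<in> X" "S \<inter> S' \<noteq> {}"
      using X(1) i uv unfolding consistent_def by fastforce
    then show "\<exists>B\<in>D v. A \<inter> B \<noteq> {}"
      using j i unfolding D_def by (intro bexI[of _ "nth cs ` S'"]) auto
  qed auto
  then obtain f where f: "\<And>v. v \<in> users N \<Longrightarrow> f v \<in> D v"
    "\<And>u v. {u, v} \<in> potential_edges N \<Longrightarrow> f u \<inter> f v \<noteq> {}" by blast
  have "f u \<subseteq> spec_map N u \<and> card (f u) \<le> budget N u" if u: "u \<in> users N" for u
  proof -
    obtain i S where i: "f u = nth cs ` S" "(i, S) \<in> X" "us ! i = u" using f(1)[OF u] unfolding D_def by blast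
    have S: "S \<subseteq> {c. c < num_channels \<and> index_spec i c}" "card S \<le> index_budget i"
      using cand[OF i(2)] by (auto simp: cands_def)
    then have "finite S" by (auto intro: finite_subset)
    with S i card_image_le[of S "nth cs"] show ?thesis by auto
  qed
  with f(2) show "connectable N" unfolding connectable_tree_iff[OF tree] spectrum_assignment_def by blast
qed

text \<open>Without channels no edge can be realized, so the tree must have no edges and hence a
  single vertex.\<close>

lemma connectable_no_channels:
  assumes "num_channels = 0"
  shows "connectable N \<longleftrightarrow> num_users = 1"
proof
  have simple: "simple_graph (users N) (potential_edges N)" using tree by (simp add: tree_graph_def)
  {
    assume "connectable N"
    then obtain SA where SA: "spectrum_assignment N SA"
      "\<And>u v. {u, v} \<in> potential_edges N \<Longrightarrow> SA u \<inter> SA v \<noteq> {}"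
      using connectable_tree_iff[OF tree] by blast
    have "channels N = {}" using assms cs by (auto simp: enumerates_def)
    then have no_edge: "{u, v} \<notin> potential_edges N" for u v
      using SA network simple_graph_edge(1)[OF simple]
      unfolding spectrum_assignment_def cognitive_radio_network_def by blast
    have "us ! 0 = us ! i" if "i < num_users" for i
    proof -
      have "(us ! 0, us ! i) \<in> {(x, y). {x, y} \<in> potential_edges N}\<^sup>*"
        using tree user_index num_users_pos that unfolding tree_graph_def connected_graph_def by blast
      then show ?thesis by (rule converse_rtranclE) (use no_edge in auto)
    qed
    then have "0 = i" if "i < num_users" for i
      using us num_users_pos that unfolding enumerates_def by (metis nth_eq_iff_index_eq)
    from this[of 1] num_users_pos show "num_users = 1" by linarith
  next
    assume "num_users = 1"
    then have "u = us ! 0" if "u \<in> users N" for u using user_index that by auto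
    then have "{u, v} \<notin> potential_edges N" for u v using simple_graph_edge[OF simple] by metis
    then show "connectable N" unfolding connectable_tree_iff[OF tree] spectrum_assignment_def
      by (intro exI[of _ "\<lambda>_. {}"]) simp
  }
qed

text \<open>For positive \<open>k\<close> this choice of \<open>W\<close> dominates
  \<open>n\<close>, \<open>k\<close> and the number of candidates, hence all loop limits. The
  maximum with 1 keeps \<open>W\<close> positive when there are no channels.\<close>

lemma runs_decide_connectable:
  "runs (2 ^ max_spec N * max 1 (num_channels * num_users)) decide_connectable (input_store N us cs)
     (\<lambda>s. s ''result'' 0 = of_bool (connectable N))"
proof (rule runs_mono[OF decide_connectable[OF _ _ _ num_users_pos inputs_input_store]])
  let ?W = "2 ^ max_spec N * max 1 (num_channels * num_users)"
  assume k: "num_channels > 0"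
  have "1 * (num_channels * num_users) \<le> ?W" by (rule mult_le_mono) simp_all
  moreover have "num_users \<le> num_channels * num_users" "num_channels \<le> num_channels * num_users"
    using k num_users_pos by (cases num_channels, simp_all) (cases num_users, simp_all)
  ultimately show "num_users \<le> ?W" "num_channels \<le> ?W" by linarith+
  note card_cands_le
  also have "num_users * 2 ^ max_spec N \<le> max 1 (num_channels * num_users) * 2 ^ max_spec N"
    using \<open>num_users \<le> num_channels * num_users\<close> by (intro mult_le_mono1 max.coboundedI2)
  also have "\<dots> = ?W" by (rule mult.commute)
  finally show "card cands \<le> ?W" .
next
  show "\<forall>x. x \<notin> {''n'', ''k'', ''budget'', ''spec'', ''adj''} \<longrightarrow> input_store N us cs x = (\<lambda>_. 0)"
    by (simp add: input_store_def)
next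
  fix s assume "s ''result'' 0 = of_bool (if num_channels = 0 then num_users = 1
    else \<exists>X S. consistent X \<and> (0, S) \<in> X)"
  then show "s ''result'' 0 = of_bool (connectable N)"
    using connectable_no_channels connectable_iff_consistent by auto
qed

end

section \<open>The two running time bounds\<close>

lemma time_bound_channels:
  fixes C d k n t :: nat
  assumes "0 < n" "t \<le> k"
  shows "C * (2 ^ t * max 1 (k * n)) ^ d \<le> C * 2 ^ (2 * d * k) * n ^ d"
proof -
  \<comment> \<open>The factor \<open>k\<close> and the factor \<open>2 ^ t\<close> are each
    absorbed by \<open>2 ^ k\<close>, whence the exponent \<open>2 * d * k\<close>.\<close>
  have "k \<le> 2 ^ k" by (simp add: less_imp_le)
  then have "max 1 (k * n) \<le> 2 ^ k * n" using assms(1) by simp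
  moreover have "(2::nat) ^ t \<le> 2 ^ k" using assms(2) by (simp add: power_increasing)
  ultimately have "2 ^ t * max 1 (k * n) \<le> 2 ^ k * (2 ^ k * n)" by (rule mult_le_mono[rotated])
  then have "(2 ^ t * max 1 (k * n)) ^ d \<le> (2 ^ k * (2 ^ k * n)) ^ d" by (rule power_mono) simp
  also have "\<dots> = 2 ^ (2 * d * k) * n ^ d"
    by (simp add: power_mult_distrib mult_2 power_add[symmetric] power_mult[symmetric] algebra_simps)
  finally show ?thesis by (metis mult.assoc mult_le_mono2)
qed

theorem theorem9:
  shows "\<exists>(P :: com) a b c a' b' c'.
    \<forall>(N :: (nat, nat) network) us cs.
      cognitive_radio_network N \<longrightarrow>
      tree_graph (users N) (potential_edges N) \<longrightarrow>
      enumerates us (users N) \<longrightarrow>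
      enumerates cs (channels N) \<longrightarrow>
      (let n = card (users N); k = card (channels N); t = max_spec N in
        \<exists>T s. exec P (input_store N us cs) T s \<and>
          s ''result'' 0 = (if connectable N then 1 else 0) \<and>
          T \<le> c * 2 ^ (a * t) * (max 1 (k * n)) ^ b \<and>
          T \<le> c' * 2 ^ (a' * k) * n ^ b')"
proof -
  obtain C d where C: "\<And>W. 0 < W \<Longrightarrow> tcost W decide_connectable \<le> C * W ^ d"
    using tcost_polynomial by blast
  show ?thesis
  \<comment> \<open>Both bounds come from \<open>C * W ^ d\<close>: the first by distributing the
    power, with \<open>d\<close> in both exponents, the second from
    \<open>time_bound_channels\<close>, with \<open>2 * d\<close> as the coefficient of
    \<open>k\<close>.\<close>
  proof (rule exI[of _ decide_connectable], rule exI[of _ d], rule exI[of _ d], rule exI[of _ C],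
      rule exI[of _ "2 * d"], rule exI[of _ d], rule exI[of _ C], intro allI impI)
    fix N :: "(nat, nat) network" and us cs
    assume N: "cognitive_radio_network N" "tree_graph (users N) (potential_edges N)"
      "enumerates us (users N)" "enumerates cs (channels N)"
    let ?W = "2 ^ max_spec N * max 1 (length cs * length us)"
    have card: "card (users N) = length us" "card (channels N) = length cs"
      using N(3,4) unfolding enumerates_def by (metis distinct_card)+
    obtain T s where T: "exec decide_connectable (input_store N us cs) T s" "T \<le> tcost ?W decide_connectable"
      "s ''result'' 0 = of_bool (connectable N)"
      using runs_decide_connectable[OF N] unfolding runs_def by blast
    have bound: "T \<le> C * ?W ^ d" using T(2) C[of ?W] by fastforce
    also have "\<dots> = C * 2 ^ (d * max_spec N) * max 1 (length cs * length us) ^ d"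
      by (simp add: power_mult_distrib power_mult[symmetric] mult.commute)
    finally have "T \<le> C * 2 ^ (d * max_spec N) * max 1 (length cs * length us) ^ d" .
    moreover have "T \<le> C * 2 ^ (2 * d * length cs) * length us ^ d"
      using bound time_bound_channels[OF num_users_pos[OF N] max_spec_le[OF N]] by (rule le_trans)
    ultimately show "let n = card (users N); k = card (channels N); t = max_spec N in
        \<exists>T s. exec decide_connectable (input_store N us cs) T s \<and>
          s ''result'' 0 = (if connectable N then 1 else 0) \<and>
          T \<le> C * 2 ^ (d * t) * (max 1 (k * n)) ^ d \<and>
          T \<le> C * 2 ^ (2 * d * k) * n ^ d"
      unfolding Let_def card using T(1,3) by (intro exI[of _ T] exI[of _ s] conjI) simp_all
  qed
qed

end
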